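(* Every finitely presented unital $\ell$-group is hopfian, and every finitely generated projective unital $\ell$-group is hopfian.
   Context: A unital $\ell$-group $(G,u)$ is an abelian group $G$ with a translation-invariant lattice order and a distinguished unit $u\geq 0$ such that every $0\le x\in G$ is dominated by some integer multiple of $u$. All unital $\ell$-groups are assumed nontrivial. Homomorphisms preserve the group structure, the lattice structure and the unit. $(G,u)$ is finitely presented in the categorical sense of Gabriel–Ulmer (the functor $\mathrm{Hom}((G,u),-)$ on the category of unital $\ell$-groups preserves filtered colimits); equivalently, the MV-algebra $\Gamma(G,u)=([0,u],0,\neg,\oplus)$ with $\neg x=u-x$ and $x\oplus y=\min(u,x+y)$ is a finitely presented MV-algebra. (An MV-algebra is an abelian monoid $(A,0,\oplus)$ with a unary operation $\neg$ satisfying $\neg\neg x=x$, $x\oplus\neg 0=\neg 0$ and $\neg(\neg x\oplus y)\oplus y=\neg(\neg y\oplus x)\oplus x$.) $(G,u)$ is projective if whenever $\psi\colon(K,w)\to(H,v)$ is a surjective homomorphism of unital $\ell$-groups and $\phi\colon(G,u)\to(H,v)$ is a homomorphism, there is a homomorphism $\theta\colon(G,u)\to(K,w)$ with $\phi=\psi\circ\theta$. $(G,u)$ is hopfian if every homomorphism of $(G,u)$ onto $(G,u)$ is an automorphism. *)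

theory Defs
  imports "HOL-Algebra.Group" "HOL-Algebra.Lattice"
begin

section \<open>Unital lattice-ordered abelian groups\<close>

text \<open>
  As everywhere in HOL-Algebra, the abelian group is written multiplicatively: the sum of
  \<open>x\<close> and \<open>y\<close> is \<open>x \<otimes> y\<close>, the zero element is \<open>\<one>\<close>, and the multiple \<open>n x\<close> is \<open>x [^] n\<close>.
\<close>

record 'a ulgroup = "'a monoid" +
  ulg_le :: "'a \<Rightarrow> 'a \<Rightarrow> bool"
  ulg_unit :: 'a

definition ulg_order :: "('a, 'b) ulgroup_scheme \<Rightarrow> 'a gorder" where
  "ulg_order G = \<lparr>carrier = carrier G, eq = (=), le = ulg_le G\<rparr>"

locale unital_lgroup = comm_group G for G (structure) +
  assumes lattice_order: "lattice (ulg_order G)"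
    and translation_invariant:
      "\<lbrakk>x \<in> carrier G; y \<in> carrier G; z \<in> carrier G; ulg_le G x y\<rbrakk>
        \<Longrightarrow> ulg_le G (z \<otimes> x) (z \<otimes> y)"
    and unit_closed: "ulg_unit G \<in> carrier G"
    and unit_nonneg: "ulg_le G \<one> (ulg_unit G)"
    and unit_dominates:
      "\<lbrakk>x \<in> carrier G; ulg_le G \<one> x\<rbrakk> \<Longrightarrow> \<exists>n::int. ulg_le G x (ulg_unit G [^] n)"
    and nontrivial: "carrier G \<noteq> {\<one>}"

text \<open>
  Morphisms are taken to be \<^const>\<open>extensional\<close>, so that two of them are equal as HOL functions
  iff they agree on the carrier; accordingly they are composed with \<^const>\<open>compose\<close>.
\<close>

definition ulg_hom :: "('a, 'c) ulgroup_scheme \<Rightarrow> ('b, 'd) ulgroup_scheme \<Rightarrow> ('a \<Rightarrow> 'b) set" where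
  "ulg_hom G H = {h \<in> hom G H \<inter> extensional (carrier G).
     (\<forall>x\<in>carrier G. \<forall>y\<in>carrier G.
        h (x \<squnion>\<^bsub>ulg_order G\<^esub> y) = h x \<squnion>\<^bsub>ulg_order H\<^esub> h y \<and>
        h (x \<sqinter>\<^bsub>ulg_order G\<^esub> y) = h x \<sqinter>\<^bsub>ulg_order H\<^esub> h y) \<and>
     h (ulg_unit G) = ulg_unit H}"

definition ulg_epi :: "('a, 'c) ulgroup_scheme \<Rightarrow> ('b, 'd) ulgroup_scheme \<Rightarrow> ('a \<Rightarrow> 'b) set" where
  "ulg_epi G H = {h \<in> ulg_hom G H. h ` carrier G = carrier H}"

definition ulg_iso :: "('a, 'c) ulgroup_scheme \<Rightarrow> ('b, 'd) ulgroup_scheme \<Rightarrow> ('a \<Rightarrow> 'b) set" where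
  "ulg_iso G H = {h \<in> ulg_hom G H. bij_betw h (carrier G) (carrier H)}"

definition hopfian :: "('a, 'c) ulgroup_scheme \<Rightarrow> bool" where
  "hopfian G \<longleftrightarrow> ulg_epi G G \<subseteq> ulg_iso G G"

definition unital_lsubgroup :: "'a set \<Rightarrow> ('a, 'c) ulgroup_scheme \<Rightarrow> bool" where
  "unital_lsubgroup S G \<longleftrightarrow> subgroup S G \<and> ulg_unit G \<in> S \<and>
     (\<forall>x\<in>S. \<forall>y\<in>S. x \<squnion>\<^bsub>ulg_order G\<^esub> y \<in> S \<and> x \<sqinter>\<^bsub>ulg_order G\<^esub> y \<in> S)"

definition finitely_generated :: "('a, 'c) ulgroup_scheme \<Rightarrow> bool" where
  "finitely_generated G \<longleftrightarrow> (\<exists>X. finite X \<and> X \<subseteq> carrier G \<and>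
     (\<forall>S. unital_lsubgroup S G \<and> X \<subseteq> S \<longrightarrow> S = carrier G))"

text \<open>
  The notions below quantify over unital \<open>\<ell>\<close>-groups other than \<open>G\<close>. HOL cannot quantify over
  types inside a formula, so the type \<open>'a\<close> of the elements of \<open>G\<close> serves as the universe: test
  objects have their carriers in \<open>'a\<close>, and small categories have their objects and arrows in
  \<open>'a\<close>. Nothing is lost: a nontrivial unital \<open>\<ell>\<close>-group is infinite, so \<open>'a\<close> is infinite and
  contains copies of all unital \<open>\<ell>\<close>-groups of cardinality at most that of \<open>'a\<close>, among them the
  \<open>\<ell>\<close>-groups presented by generators in \<open>'a\<close>, and the colimits of all diagrams of such groups
  indexed by small categories. In any case, testing on fewer objects only weakens a hypothesis
  that \<open>G\<close> is projective or finitely presented.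
\<close>

definition projective :: "'a ulgroup \<Rightarrow> bool" where
  "projective G \<longleftrightarrow> (\<forall>(K :: 'a ulgroup) (H :: 'a ulgroup) \<psi> \<phi>.
     unital_lgroup K \<and> unital_lgroup H \<and> \<psi> \<in> ulg_epi K H \<and> \<phi> \<in> ulg_hom G H
     \<longrightarrow> (\<exists>\<theta>\<in>ulg_hom G K. \<phi> = compose (carrier G) \<psi> \<theta>))"


section \<open>Filtered colimits\<close>

text \<open>
  \<open>Comp J i j k g f\<close> is the composite of \<open>f \<in> Arr J i j\<close> followed by \<open>g \<in> Arr J j k\<close>. Different
  hom-sets are allowed to overlap.
\<close>

record ('o, 'm) small_category =
  Obj :: "'o set"
  Arr :: "'o \<Rightarrow> 'o \<Rightarrow> 'm set"
  Ide :: "'o \<Rightarrow> 'm"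
  Comp :: "'o \<Rightarrow> 'o \<Rightarrow> 'o \<Rightarrow> 'm \<Rightarrow> 'm \<Rightarrow> 'm"

locale small_category =
  fixes J :: "('o, 'm) small_category"
  assumes ide_closed: "i \<in> Obj J \<Longrightarrow> Ide J i \<in> Arr J i i"
    and comp_closed:
      "\<lbrakk>i \<in> Obj J; j \<in> Obj J; k \<in> Obj J; f \<in> Arr J i j; g \<in> Arr J j k\<rbrakk>
        \<Longrightarrow> Comp J i j k g f \<in> Arr J i k"
    and comp_ide_right:
      "\<lbrakk>i \<in> Obj J; j \<in> Obj J; f \<in> Arr J i j\<rbrakk> \<Longrightarrow> Comp J i i j f (Ide J i) = f"
    and comp_ide_left:
      "\<lbrakk>i \<in> Obj J; j \<in> Obj J; f \<in> Arr J i j\<rbrakk> \<Longrightarrow> Comp J i j j (Ide J j) f = f"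
    and comp_assoc:
      "\<lbrakk>i \<in> Obj J; j \<in> Obj J; k \<in> Obj J; l \<in> Obj J;
        f \<in> Arr J i j; g \<in> Arr J j k; h \<in> Arr J k l\<rbrakk>
        \<Longrightarrow> Comp J i j l (Comp J j k l h g) f = Comp J i k l h (Comp J i j k g f)"

locale filtered_category = small_category +
  assumes nonempty: "Obj J \<noteq> {}"
    and upper_bound:
      "\<lbrakk>i \<in> Obj J; j \<in> Obj J\<rbrakk> \<Longrightarrow> \<exists>k\<in>Obj J. Arr J i k \<noteq> {} \<and> Arr J j k \<noteq> {}"
    and coequalizing:
      "\<lbrakk>i \<in> Obj J; j \<in> Obj J; f \<in> Arr J i j; g \<in> Arr J i j\<rbrakk>
        \<Longrightarrow> \<exists>k\<in>Obj J. \<exists>h\<in>Arr J j k. Comp J i j k h f = Comp J i j k h g"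

locale ulg_diagram = small_category J
  for J :: "('o, 'm) small_category" +
  fixes D :: "'o \<Rightarrow> 'a ulgroup"
    and T :: "'o \<Rightarrow> 'o \<Rightarrow> 'm \<Rightarrow> 'a \<Rightarrow> 'a"
  assumes obj: "i \<in> Obj J \<Longrightarrow> unital_lgroup (D i)"
    and arr: "\<lbrakk>i \<in> Obj J; j \<in> Obj J; f \<in> Arr J i j\<rbrakk> \<Longrightarrow> T i j f \<in> ulg_hom (D i) (D j)"
    and preserves_ide: "i \<in> Obj J \<Longrightarrow> T i i (Ide J i) = restrict id (carrier (D i))"
    and preserves_comp:
      "\<lbrakk>i \<in> Obj J; j \<in> Obj J; k \<in> Obj J; f \<in> Arr J i j; g \<in> Arr J j k\<rbrakk>
        \<Longrightarrow> T i k (Comp J i j k g f) = compose (carrier (D i)) (T j k g) (T i j f)"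

definition ulg_cocone ::
  "('o, 'm) small_category \<Rightarrow> ('o \<Rightarrow> 'a ulgroup) \<Rightarrow> ('o \<Rightarrow> 'o \<Rightarrow> 'm \<Rightarrow> 'a \<Rightarrow> 'a) \<Rightarrow>
   'a ulgroup \<Rightarrow> ('o \<Rightarrow> 'a \<Rightarrow> 'a) \<Rightarrow> bool" where
  "ulg_cocone J D T L c \<longleftrightarrow> unital_lgroup L \<and>
     (\<forall>i\<in>Obj J. c i \<in> ulg_hom (D i) L) \<and>
     (\<forall>i\<in>Obj J. \<forall>j\<in>Obj J. \<forall>f\<in>Arr J i j. compose (carrier (D i)) (c j) (T i j f) = c i)"

definition ulg_colimit ::
  "('o, 'm) small_category \<Rightarrow> ('o \<Rightarrow> 'a ulgroup) \<Rightarrow> ('o \<Rightarrow> 'o \<Rightarrow> 'm \<Rightarrow> 'a \<Rightarrow> 'a) \<Rightarrow>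
   'a ulgroup \<Rightarrow> ('o \<Rightarrow> 'a \<Rightarrow> 'a) \<Rightarrow> bool" where
  "ulg_colimit J D T L c \<longleftrightarrow> ulg_cocone J D T L c \<and>
     (\<forall>M d. ulg_cocone J D T M d \<longrightarrow>
        (\<exists>!h. h \<in> ulg_hom L M \<and> (\<forall>i\<in>Obj J. compose (carrier (D i)) h (c i) = d i)))"


section \<open>Finitely presented objects in the sense of Gabriel and Ulmer\<close>

text \<open>
  The colimit in the category of sets of the diagram \<open>i \<mapsto> ulg_hom G (D i)\<close>, in its standard
  construction: the disjoint union of these sets, modulo the equivalence relation generated by
  identifying every \<open>g \<in> ulg_hom G (D i)\<close> with its image in \<open>ulg_hom G (D j)\<close> under each
  arrow \<open>f \<in> Arr J i j\<close>.
\<close>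

definition hom_sum ::
  "'a ulgroup \<Rightarrow> ('o, 'm) small_category \<Rightarrow> ('o \<Rightarrow> 'a ulgroup) \<Rightarrow> ('o \<times> ('a \<Rightarrow> 'a)) set" where
  "hom_sum G J D = (SIGMA i:Obj J. ulg_hom G (D i))"

definition hom_step ::
  "'a ulgroup \<Rightarrow> ('o, 'm) small_category \<Rightarrow> ('o \<Rightarrow> 'a ulgroup) \<Rightarrow>
   ('o \<Rightarrow> 'o \<Rightarrow> 'm \<Rightarrow> 'a \<Rightarrow> 'a) \<Rightarrow> 'o \<times> ('a \<Rightarrow> 'a) \<Rightarrow> 'o \<times> ('a \<Rightarrow> 'a) \<Rightarrow> bool" where
  "hom_step G J D T p q \<longleftrightarrow> p \<in> hom_sum G J D \<and> q \<in> hom_sum G J D \<and>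
     (\<exists>f\<in>Arr J (fst p) (fst q). snd q = compose (carrier G) (T (fst p) (fst q) f) (snd p))"

definition hom_colimit ::
  "'a ulgroup \<Rightarrow> ('o, 'm) small_category \<Rightarrow> ('o \<Rightarrow> 'a ulgroup) \<Rightarrow>
   ('o \<Rightarrow> 'o \<Rightarrow> 'm \<Rightarrow> 'a \<Rightarrow> 'a) \<Rightarrow> ('o \<times> ('a \<Rightarrow> 'a)) set set" where
  "hom_colimit G J D T = hom_sum G J D //
     {(p, q) \<in> hom_sum G J D \<times> hom_sum G J D. equivclp (hom_step G J D T) p q}"

text \<open>
  The canonical map from this colimit to \<open>ulg_hom G L\<close>, where \<open>c\<close> is a cocone with vertex \<open>L\<close>.
  It sends the class of \<open>(i, g)\<close> to \<open>c i \<circ> g\<close>, which does not depend on the representative.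
\<close>

definition hom_colimit_map ::
  "'a ulgroup \<Rightarrow> ('o \<Rightarrow> 'a \<Rightarrow> 'a) \<Rightarrow> ('o \<times> ('a \<Rightarrow> 'a)) set \<Rightarrow> 'a \<Rightarrow> 'a" where
  "hom_colimit_map G c X = the_elem ((\<lambda>(i, g). compose (carrier G) (c i) g) ` X)"

definition finitely_presented :: "'a ulgroup \<Rightarrow> bool" where
  "finitely_presented G \<longleftrightarrow>
     (\<forall>(J :: ('a, 'a) small_category) D T (L :: 'a ulgroup) c.
        filtered_category J \<and> ulg_diagram J D T \<and> ulg_colimit J D T L c
        \<longrightarrow> bij_betw (hom_colimit_map G c) (hom_colimit G J D T) (ulg_hom G L))"

end

(* Malcev's argument. Homomorphisms from G into the chains (Z, d) correspond to rational points of
   denominator d. If G is finitely generated there are finitely many of them for each d, so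
   composition with a surjective endomorphism of G permutes them; hence the kernel is killed by all
   of them, and G is hopfian as soon as they separate its points.

   For a term t vanishing in G, let D_t be the group of functions that the terms in the variables
   of t and the unit induce on the integer points q where t vanishes (with q(u) > 0 as
   denominator); there the points separate by construction. A term that vanishes on all these
   points vanishes in G: otherwise a prime cone of G excludes it or its inverse, and modulo that
   cone all terms involved are linear forms, whose signs are realised at an integer point by
   Fourier--Motzkin elimination. So D_t maps to G, and G is the filtered colimit of the D_t.
   If G is finitely presented, or finitely generated and projective, the identity of G factors
   through some D_t, which therefore passes its separating homomorphisms on to G. *)

theory Submission
  imports Defs "HOL-Algebra.FiniteProduct" Complex_Main
begin

section \<open>Order and prime cones\<close>

text \<open>The obstacle is the unit axiom: domination by multiples of the unit is not an equation,
  and the group of all term functions on the zero set of a term violates it in general. The point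
  sets therefore impose on each variable the bound by a multiple of the unit that this element
  satisfies in G. Separation survives the extra conditions, because they are inequalities that
  belong to every prime cone of G. A single term per index suffices, since t = 0 and t' = 0 together
  amount to |t| + |t'| = 0; so the index preorder is directed. The test objects of both categorical
  hypotheses must have their elements in the type of G. Term functions are therefore named by chosen
  terms instead of classes, and terms are coded injectively in the infinite type \<open>'a\<close>.
  Malcev's argument asks for finite generation. A finitely presented G receives it from the
  factorisation: if the map from D_t to G has a section, every element of G is the value of a term
  in the finitely many variables of t and the unit.\<close>

lemma carrier_ulg_order [simp]: "carrier (ulg_order G) = carrier G"
  and le_ulg_order [simp]: "le (ulg_order G) = ulg_le G"
  and eq_ulg_order [simp]: "eq (ulg_order G) = (=)"
  by (simp_all add: ulg_order_def)

context unital_lgroup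
begin

abbreviation lg_le (infix "\<preceq>" 50) where "x \<preceq> y \<equiv> ulg_le G x y"
abbreviation lg_join (infixl "\<curlyvee>" 65) where "x \<curlyvee> y \<equiv> x \<squnion>\<^bsub>ulg_order G\<^esub> y"
abbreviation lg_meet (infixl "\<curlywedge>" 65) where "x \<curlywedge> y \<equiv> x \<sqinter>\<^bsub>ulg_order G\<^esub> y"
abbreviation lg_unit ("\<u>") where "\<u> \<equiv> ulg_unit G"

interpretation L: lattice "ulg_order G"
  by (rule lattice_order)

lemma le_refl [simp]: "x \<in> carrier G \<Longrightarrow> x \<preceq> x"
  using L.le_refl by simp

lemma le_trans [trans]:
  "x \<preceq> y \<Longrightarrow> y \<preceq> z \<Longrightarrow> x \<in> carrier G \<Longrightarrow> y \<in> carrier G \<Longrightarrow> z \<in> carrier G \<Longrightarrow> x \<preceq> z"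
  using L.le_trans by simp

lemma le_antisym: "x \<preceq> y \<Longrightarrow> y \<preceq> x \<Longrightarrow> x \<in> carrier G \<Longrightarrow> y \<in> carrier G \<Longrightarrow> x = y"
  using L.le_antisym by simp

lemma join_closed [simp]: "x \<in> carrier G \<Longrightarrow> y \<in> carrier G \<Longrightarrow> x \<curlyvee> y \<in> carrier G"
  using L.join_closed by simp

lemma meet_closed [simp]: "x \<in> carrier G \<Longrightarrow> y \<in> carrier G \<Longrightarrow> x \<curlywedge> y \<in> carrier G"
  using L.meet_closed by simp

lemma join_upper1: "x \<in> carrier G \<Longrightarrow> y \<in> carrier G \<Longrightarrow> x \<preceq> x \<curlyvee> y"
  using L.join_left by simp

lemma join_upper2: "x \<in> carrier G \<Longrightarrow> y \<in> carrier G \<Longrightarrow> y \<preceq> x \<curlyvee> y"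
  using L.join_right by simp

lemma join_least:
  "x \<preceq> z \<Longrightarrow> y \<preceq> z \<Longrightarrow> x \<in> carrier G \<Longrightarrow> y \<in> carrier G \<Longrightarrow> z \<in> carrier G \<Longrightarrow> x \<curlyvee> y \<preceq> z"
  using L.join_le by simp

lemma meet_lower1: "x \<in> carrier G \<Longrightarrow> y \<in> carrier G \<Longrightarrow> x \<curlywedge> y \<preceq> x"
  using L.meet_left by simp

lemma meet_lower2: "x \<in> carrier G \<Longrightarrow> y \<in> carrier G \<Longrightarrow> x \<curlywedge> y \<preceq> y"
  using L.meet_right by simp

lemma meet_greatest:
  "z \<preceq> x \<Longrightarrow> z \<preceq> y \<Longrightarrow> x \<in> carrier G \<Longrightarrow> y \<in> carrier G \<Longrightarrow> z \<in> carrier G \<Longrightarrow> z \<preceq> x \<curlywedge> y"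
  using L.meet_le by simp

lemma join_eqI:
  assumes "x \<in> carrier G" "y \<in> carrier G" "z \<in> carrier G" "x \<preceq> z" "y \<preceq> z"
    and "\<And>w. w \<in> carrier G \<Longrightarrow> x \<preceq> w \<Longrightarrow> y \<preceq> w \<Longrightarrow> z \<preceq> w"
  shows "x \<curlyvee> y = z"
proof (rule le_antisym)
  show "z \<preceq> x \<curlyvee> y" using assms by (intro assms(6)) (auto intro: join_upper1 join_upper2)
  show "x \<curlyvee> y \<preceq> z" using assms by (intro join_least) auto
qed (use assms in auto)

lemma meet_eqI:
  assumes "x \<in> carrier G" "y \<in> carrier G" "z \<in> carrier G" "z \<preceq> x" "z \<preceq> y"
    and "\<And>w. w \<in> carrier G \<Longrightarrow> w \<preceq> x \<Longrightarrow> w \<preceq> y \<Longrightarrow> w \<preceq> z"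
  shows "x \<curlywedge> y = z"
proof (rule le_antisym)
  show "x \<curlywedge> y \<preceq> z" using assms by (intro assms(6)) (auto intro: meet_lower1 meet_lower2)
  show "z \<preceq> x \<curlywedge> y" using assms by (intro meet_greatest) auto
qed (use assms in auto)

lemma le_iff_join: "x \<in> carrier G \<Longrightarrow> y \<in> carrier G \<Longrightarrow> x \<preceq> y \<longleftrightarrow> x \<curlyvee> y = y"
  by (metis join_eqI join_upper1 le_refl)

lemma mult_left_le_iff:
  assumes "x \<in> carrier G" "y \<in> carrier G" "z \<in> carrier G"
  shows "z \<otimes> x \<preceq> z \<otimes> y \<longleftrightarrow> x \<preceq> y"
proof
  assume "z \<otimes> x \<preceq> z \<otimes> y"
  then have "inv z \<otimes> (z \<otimes> x) \<preceq> inv z \<otimes> (z \<otimes> y)"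
    using translation_invariant [of "z \<otimes> x" "z \<otimes> y" "inv z"] assms by simp
  then show "x \<preceq> y" using assms by (simp add: m_assoc [symmetric] l_inv)
qed (use assms translation_invariant in auto)

lemma mult_right_le_iff:
  assumes "x \<in> carrier G" "y \<in> carrier G" "z \<in> carrier G"
  shows "x \<otimes> z \<preceq> y \<otimes> z \<longleftrightarrow> x \<preceq> y"
  using assms mult_left_le_iff by (simp add: m_comm)

lemma mult_mono_le:
  assumes "x \<preceq> y" "z \<preceq> w" "x \<in> carrier G" "y \<in> carrier G" "z \<in> carrier G" "w \<in> carrier G"
  shows "x \<otimes> z \<preceq> y \<otimes> w"
  using le_trans [of "x \<otimes> z" "y \<otimes> z" "y \<otimes> w"] assms
  by (simp add: mult_left_le_iff mult_right_le_iff)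

lemma le_diff_iff:
  assumes "x \<in> carrier G" "y \<in> carrier G" "z \<in> carrier G"
  shows "x \<preceq> inv z \<otimes> y \<longleftrightarrow> z \<otimes> x \<preceq> y"
  using mult_left_le_iff [of x "inv z \<otimes> y" z] assms by (simp add: m_assoc [symmetric])

lemma one_le_diff_iff:
  assumes "x \<in> carrier G" "y \<in> carrier G"
  shows "\<one> \<preceq> inv x \<otimes> y \<longleftrightarrow> x \<preceq> y"
  using le_diff_iff [of \<one> y x] assms by simp

lemma inv_le_iff:
  assumes "x \<in> carrier G" "y \<in> carrier G"
  shows "inv x \<preceq> inv y \<longleftrightarrow> y \<preceq> x"
  using assms one_le_diff_iff [of "inv x" "inv y"] one_le_diff_iff [of y x] by (simp add: m_comm)

text \<open>Inversion reverses the order. This eliminates meets: terms have no constructor for them,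
  and \<open>ulg_homI\<close> derives their preservation from that of joins.\<close>

lemma meet_conv_join:
  assumes "x \<in> carrier G" "y \<in> carrier G"
  shows "x \<curlywedge> y = inv (inv x \<curlyvee> inv y)"
proof (rule meet_eqI)
  show "inv (inv x \<curlyvee> inv y) \<preceq> x"
    using assms inv_le_iff [of "inv x \<curlyvee> inv y" "inv x"] join_upper1 [of "inv x" "inv y"] by simp
  show "inv (inv x \<curlyvee> inv y) \<preceq> y"
    using assms inv_le_iff [of "inv x \<curlyvee> inv y" "inv y"] join_upper2 [of "inv x" "inv y"] by simp
  fix w assume w: "w \<in> carrier G" "w \<preceq> x" "w \<preceq> y"
  then have "inv x \<curlyvee> inv y \<preceq> inv w"
    using assms by (intro join_least) (auto simp: inv_le_iff)
  then show "w \<preceq> inv (inv x \<curlyvee> inv y)"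
    using assms w inv_le_iff [of "inv (inv x \<curlyvee> inv y)" w] by simp
qed (use assms in auto)

lemma pow_le_one:
  assumes "a \<in> carrier G" "a \<preceq> \<one>"
  shows "a [^] (n::nat) \<preceq> \<one>"
proof (induction n)
  case (Suc n)
  then show ?case using mult_mono_le [OF Suc assms(2)] assms by simp
qed simp

lemma unit_ge_one_pow: "\<one> \<preceq> \<u> [^] (n::nat)"
proof (induction n)
  case (Suc n)
  then show ?case using mult_mono_le [OF Suc unit_nonneg] unit_closed by simp
qed simp

text \<open>The axiom speaks of elements above zero and of integer multiples. Joining with zero
  takes care of the first; a negative multiple of the unit lies below zero, so in that case the
  exponent 0 works.\<close>

lemma unit_bound:
  assumes "x \<in> carrier G"
  shows "\<exists>n::nat. x \<preceq> \<u> [^] n"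
proof -
  note unit_closed [simp]
  have "x \<curlyvee> \<one> \<in> carrier G" "\<one> \<preceq> x \<curlyvee> \<one>" using assms join_upper2 by auto
  then obtain k :: int where k: "x \<curlyvee> \<one> \<preceq> \<u> [^] k"
    using unit_dominates by blast
  show ?thesis
  proof (cases "k \<ge> 0")
    case True
    then have "\<u> [^] k = \<u> [^] nat k" by (metis int_pow_int nat_0_le)
    then have "x \<preceq> \<u> [^] nat k"
      using k assms le_trans [OF join_upper1 [of x \<one>] k] by simp
    then show ?thesis by blast
  next
    case False
    then have eq: "\<u> [^] k = inv (\<u> [^] nat (- k))"
      by (simp add: int_pow_def nat_pow_def)
    have "\<u> [^] k \<preceq> \<one>"
      unfolding eq using inv_le_iff [of "\<u> [^] nat (- k)" \<one>] unit_ge_one_pow by simp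
    then have "x \<curlyvee> \<one> \<preceq> \<one>"
      using le_trans [OF k \<open>\<u> [^] k \<preceq> \<one>\<close>] assms by simp
    then have "x \<preceq> \<one>"
      using le_trans [OF join_upper1 [of x \<one>], of \<one>] assms by simp
    then show ?thesis by (intro exI [of _ 0]) simp
  qed
qed

lemma unit_bound2:
  assumes "x \<in> carrier G"
  shows "\<exists>n::nat. x \<preceq> \<u> [^] n \<and> inv x \<preceq> \<u> [^] n"
proof -
  note unit_closed [simp]
  obtain m n :: nat where "x \<preceq> \<u> [^] m" "inv x \<preceq> \<u> [^] n"
    using unit_bound assms inv_closed by metis
  then have "x \<preceq> \<u> [^] m \<otimes> \<u> [^] n" "inv x \<preceq> \<u> [^] m \<otimes> \<u> [^] n"
    using mult_mono_le [of x "\<u> [^] m" \<one> "\<u> [^] n"] unit_ge_one_pow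
      mult_mono_le [of \<one> "\<u> [^] m" "inv x" "\<u> [^] n"] assms by simp_all
  then show ?thesis using assms by (intro exI [of _ "m + n"]) (simp add: nat_pow_mult)
qed

text \<open>This is how nontriviality enters: it makes the multiples of the unit distinct and the
  point sets nonempty.\<close>

lemma unit_neq_one: "\<u> \<noteq> \<one>"
proof
  assume "\<u> = \<one>"
  have "x = \<one>" if x: "x \<in> carrier G" for x
  proof -
    obtain n :: nat where "x \<preceq> \<u> [^] n" "inv x \<preceq> \<u> [^] n"
      using unit_bound2 [OF x] by auto
    then have "x \<preceq> \<one>" "\<one> \<preceq> x"
      using \<open>\<u> = \<one>\<close> that inv_le_iff [of x \<one>] by simp_all
    then show ?thesis using that le_antisym by simp
  qed
  then have "carrier G = {\<one>}" by auto
  then show False using nontrivial by simp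
qed

text \<open>The nonnegative elements of a translation-invariant preorder that extends the order of
  G. Closure under meets says that joins of G remain least upper bounds for this preorder.\<close>

definition lg_cone :: "'a set \<Rightarrow> bool" where
  "lg_cone P \<longleftrightarrow> P \<subseteq> carrier G \<and> (\<forall>x\<in>carrier G. \<one> \<preceq> x \<longrightarrow> x \<in> P) \<and>
     (\<forall>x\<in>P. \<forall>y\<in>P. x \<otimes> y \<in> P \<and> x \<curlywedge> y \<in> P)"

lemma lg_coneD:
  assumes "lg_cone P"
  shows "P \<subseteq> carrier G" "x \<in> carrier G \<Longrightarrow> \<one> \<preceq> x \<Longrightarrow> x \<in> P"
    "x \<in> P \<Longrightarrow> y \<in> P \<Longrightarrow> x \<otimes> y \<in> P" "x \<in> P \<Longrightarrow> y \<in> P \<Longrightarrow> x \<curlywedge> y \<in> P"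
  using assms by (auto simp: lg_cone_def)

lemma lg_cone_upward:
  assumes "lg_cone P" "x \<in> P" "x \<preceq> y" "y \<in> carrier G"
  shows "y \<in> P"
proof -
  have "x \<in> carrier G" using assms lg_coneD by blast
  then have "inv x \<otimes> y \<in> P"
    using assms lg_coneD(2) [of P "inv x \<otimes> y"] by (simp add: one_le_diff_iff)
  then have "x \<otimes> (inv x \<otimes> y) \<in> P" using assms lg_coneD(3) by simp
  then show ?thesis using \<open>x \<in> carrier G\<close> assms by (simp add: m_assoc [symmetric])
qed

text \<open>Since \<open>a\<close> is at most zero, its powers decrease. Two elements with exponents
  \<open>m\<close> and \<open>n\<close> thus have a common lower bound with exponent
  \<open>m + n\<close>, which yields closure under meets.\<close>

lemma lg_cone_adjoin:
  assumes P: "lg_cone P" and a: "a \<in> carrier G" "a \<preceq> \<one>"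
  shows "lg_cone {z \<in> carrier G. \<exists>p\<in>P. \<exists>n::nat. p \<otimes> a [^] n \<preceq> z}" (is "lg_cone ?Q")
  unfolding lg_cone_def
proof (intro conjI ballI impI)
  fix x assume "x \<in> carrier G" "\<one> \<preceq> x"
  moreover have "x \<otimes> a [^] (0::nat) \<preceq> x" using \<open>x \<in> carrier G\<close> by simp
  ultimately show "x \<in> ?Q" using lg_coneD(2) [OF P] by blast
next
  fix x y assume "x \<in> ?Q" "y \<in> ?Q"
  then obtain p q m n where x: "x \<in> carrier G" "p \<in> P" "p \<otimes> a [^] (m::nat) \<preceq> x"
    and y: "y \<in> carrier G" "q \<in> P" "q \<otimes> a [^] (n::nat) \<preceq> y" by blast
  have pq: "p \<in> carrier G" "q \<in> carrier G" using x y P lg_coneD by blast+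
  have "(p \<otimes> a [^] m) \<otimes> (q \<otimes> a [^] n) \<preceq> x \<otimes> y"
    by (rule mult_mono_le) (use x y pq a in auto)
  moreover have "(p \<otimes> a [^] m) \<otimes> (q \<otimes> a [^] n) = (p \<otimes> q) \<otimes> a [^] (m + n)"
    using pq a by (simp add: nat_pow_mult [symmetric] m_ac)
  ultimately show "x \<otimes> y \<in> ?Q"
    using x y lg_coneD(3) [OF P] by (metis (mono_tags, lifting) m_closed mem_Collect_eq)
  have pow: "a [^] (m + n) \<preceq> a [^] m" "a [^] (m + n) \<preceq> a [^] n"
    using mult_left_le_iff [of "a [^] n" \<one> "a [^] m"] mult_right_le_iff [of "a [^] m" \<one> "a [^] n"]
      pow_le_one a by (simp_all add: nat_pow_mult [symmetric])
  have 1: "(p \<curlywedge> q) \<otimes> a [^] (m + n) \<preceq> x"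
    using mult_mono_le [OF meet_lower1 [of p q] pow(1)]
      le_trans [of "(p \<curlywedge> q) \<otimes> a [^] (m + n)" "p \<otimes> a [^] m" x] pq a x by simp
  have 2: "(p \<curlywedge> q) \<otimes> a [^] (m + n) \<preceq> y"
    using mult_mono_le [OF meet_lower2 [of p q] pow(2)]
      le_trans [of "(p \<curlywedge> q) \<otimes> a [^] (m + n)" "q \<otimes> a [^] n" y] pq a y by simp
  have "(p \<curlywedge> q) \<otimes> a [^] (m + n) \<preceq> x \<curlywedge> y"
    using 1 2 x y pq a by (intro meet_greatest) auto
  then show "x \<curlywedge> y \<in> ?Q"
    using x y lg_coneD(4) [OF P] by (metis (mono_tags, lifting) meet_closed mem_Collect_eq)
qed auto

text \<open>The hypothesis on upper bounds expresses that the join of \<open>a\<close> and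
  \<open>b\<close> is zero. Cancelling one factor \<open>a\<close> from an upper bound of
  \<open>a [^] Suc n\<close> and \<open>b\<close> leaves an upper bound of \<open>a [^] n\<close>
  and \<open>b\<close>, so induction applies.\<close>

lemma disjoint_pow:
  assumes "a \<in> carrier G" "b \<in> carrier G" "a \<preceq> \<one>" "b \<preceq> \<one>"
    and "\<And>w. w \<in> carrier G \<Longrightarrow> a \<preceq> w \<Longrightarrow> b \<preceq> w \<Longrightarrow> \<one> \<preceq> w"
    and "w \<in> carrier G" "a [^] (n::nat) \<preceq> w" "b \<preceq> w"
  shows "\<one> \<preceq> w"
  using assms(6-8)
proof (induction n arbitrary: w)
  case (Suc n)
  have "a [^] n \<preceq> inv a \<otimes> w"
    using Suc.prems assms(1) le_diff_iff [of "a [^] n" w a] m_comm [of "a [^] n" a] by simp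
  moreover have "a \<otimes> b \<preceq> \<one> \<otimes> b" by (rule mult_mono_le) (use assms in auto)
  then have "a \<otimes> b \<preceq> w" using le_trans [of "a \<otimes> b" b w] Suc.prems assms(1,2) by simp
  then have "b \<preceq> inv a \<otimes> w" using Suc.prems assms(1,2) by (simp add: le_diff_iff)
  ultimately have "\<one> \<preceq> inv a \<otimes> w" using Suc.IH Suc.prems assms(1) by simp
  then have "a \<preceq> w" using Suc.prems assms(1) by (simp add: one_le_diff_iff)
  then show ?case using Suc.prems assms(5) by blast
qed simp

text \<open>Additively, the two meets differ by y: subtracting y from the first gives a lower bound
  of -y and 0. So if w bounds both, then the first meet minus w is below y and below 0, hence below
  the first meet itself, and w is nonnegative.\<close>

lemma disjoint_parts:
  assumes y: "y \<in> carrier G" and w: "w \<in> carrier G" "y \<curlywedge> \<one> \<preceq> w" "inv y \<curlywedge> \<one> \<preceq> w"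
  shows "\<one> \<preceq> w"
proof -
  let ?a = "y \<curlywedge> \<one>"
  have a: "?a \<preceq> y" "?a \<preceq> \<one>" using y meet_lower1 meet_lower2 by auto
  have "inv y \<otimes> ?a \<preceq> inv y \<curlywedge> \<one>"
  proof (rule meet_greatest)
    show "inv y \<otimes> ?a \<preceq> inv y" using mult_mono_le [OF le_refl a(2), of "inv y"] y by simp
    show "inv y \<otimes> ?a \<preceq> \<one>" using mult_mono_le [OF le_refl a(1), of "inv y"] y by simp
  qed (use y in auto)
  then have "inv y \<otimes> ?a \<preceq> w" using le_trans w y by simp
  then have "inv w \<otimes> ?a \<preceq> y"
    using y w le_diff_iff [of "?a" w "inv y"] le_diff_iff [of "?a" y "inv w"] m_comm [of y w]
    by simp
  moreover have "inv w \<otimes> ?a \<preceq> \<one>"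
    using w y mult_left_le_iff [of "?a" w "inv w"] by simp
  ultimately have "inv w \<otimes> ?a \<preceq> \<one> \<otimes> ?a" using y w by (simp add: meet_greatest)
  then have "inv w \<preceq> inv \<one>" using y w mult_right_le_iff [of "inv w" \<one> ?a] by simp
  then show ?thesis using w inv_le_iff [of w \<one>] by simp
qed

text \<open>The prime cones are the total translation-invariant preorders compatible with the
  lattice structure; they replace the totally ordered quotients of \<open>G\<close>.\<close>

lemma prime_cone_exists:
  assumes g: "g \<in> carrier G" "\<not> \<one> \<preceq> g"
  shows "\<exists>P. lg_cone P \<and> (\<forall>y\<in>carrier G. y \<in> P \<or> inv y \<in> P) \<and> g \<notin> P"
proof -
  let ?A = "{P. lg_cone P \<and> g \<notin> P}"
  have "lg_cone {x \<in> carrier G. \<one> \<preceq> x}"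
    unfolding lg_cone_def
  proof (intro conjI ballI impI)
    fix x y assume "x \<in> {x \<in> carrier G. \<one> \<preceq> x}" "y \<in> {x \<in> carrier G. \<one> \<preceq> x}"
    then show "x \<otimes> y \<in> {x \<in> carrier G. \<one> \<preceq> x}" "x \<curlywedge> y \<in> {x \<in> carrier G. \<one> \<preceq> x}"
      using mult_mono_le [of \<one> x \<one> y] by (auto intro: meet_greatest)
  qed auto
  then have ne: "?A \<noteq> {}" using g by blast
  have chain: "\<Union>\<C> \<in> ?A" if "\<C> \<noteq> {}" and \<C>: "subset.chain ?A \<C>" for \<C>
  proof -
    have *: "\<exists>P\<in>\<C>. x \<in> P \<and> y \<in> P" if "x \<in> \<Union>\<C>" "y \<in> \<Union>\<C>" for x y
    proof -
      obtain P Q where PQ: "P \<in> \<C>" "Q \<in> \<C>" "x \<in> P" "y \<in> Q"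
        using \<open>x \<in> \<Union>\<C>\<close> \<open>y \<in> \<Union>\<C>\<close> by blast
      then have "P \<subseteq> Q \<or> Q \<subseteq> P" using \<C> by (simp add: subset_chain_def)
      then show ?thesis using PQ by auto
    qed
    have cone: "lg_cone P" "g \<notin> P" if "P \<in> \<C>" for P
      using that \<C> by (auto simp: subset_chain_def)
    have "lg_cone (\<Union>\<C>)"
      unfolding lg_cone_def
    proof (intro conjI ballI impI)
      fix x y assume "x \<in> \<Union>\<C>" "y \<in> \<Union>\<C>"
      then obtain P where "P \<in> \<C>" "x \<in> P" "y \<in> P" using * by blast
      then have "x \<otimes> y \<in> P" "x \<curlywedge> y \<in> P"
        using lg_coneD(3,4) [OF cone(1) [OF \<open>P \<in> \<C>\<close>]] by simp_all
      then show "x \<otimes> y \<in> \<Union>\<C>" "x \<curlywedge> y \<in> \<Union>\<C>"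
        using \<open>P \<in> \<C>\<close> by (auto intro: UnionI)
    next
      fix x assume "x \<in> carrier G" "\<one> \<preceq> x"
      then show "x \<in> \<Union>\<C>" using \<open>\<C> \<noteq> {}\<close> lg_coneD(2) [OF cone(1)] by auto
    next
      show "\<Union>\<C> \<subseteq> carrier G" using lg_coneD(1) [OF cone(1)] by auto
    qed
    then show ?thesis using cone(2) by auto
  qed
  obtain P where P: "lg_cone P" "g \<notin> P" and max: "\<And>Q. lg_cone Q \<Longrightarrow> g \<notin> Q \<Longrightarrow> P \<subseteq> Q \<Longrightarrow> Q = P"
    using subset_Zorn_nonempty [OF ne chain] by auto
  \<comment> \<open>The cone generated by \<open>P\<close> and \<open>y \<curlywedge> \<one>\<close>
    contains \<open>y\<close>, so by maximality of \<open>P\<close> it must contain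
    \<open>g\<close>.\<close>
  have adj: "\<exists>p\<in>P. \<exists>n::nat. p \<otimes> (y \<curlywedge> \<one>) [^] n \<preceq> g" if y: "y \<in> carrier G" "y \<notin> P" for y
  proof (rule ccontr)
    assume neg: "\<not> ?thesis"
    let ?Q = "{z \<in> carrier G. \<exists>p\<in>P. \<exists>n::nat. p \<otimes> (y \<curlywedge> \<one>) [^] n \<preceq> z}"
    have "lg_cone ?Q" using y P meet_lower2 by (intro lg_cone_adjoin) auto
    moreover have "g \<notin> ?Q" using neg by blast
    moreover have "P \<subseteq> ?Q"
    proof
      fix p assume "p \<in> P"
      moreover have "p \<in> carrier G" using \<open>p \<in> P\<close> lg_coneD(1) [OF P(1)] by auto
      moreover have "p \<otimes> (y \<curlywedge> \<one>) [^] (0::nat) \<preceq> p" using \<open>p \<in> carrier G\<close> by simp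
      ultimately show "p \<in> ?Q" by blast
    qed
    ultimately have "?Q = P" using max by simp
    have "\<one> \<otimes> (y \<curlywedge> \<one>) [^] (1::nat) \<preceq> y" using y meet_lower1 by simp
    moreover have "\<one> \<in> P" using lg_coneD(2) [OF P(1), of \<one>] by simp
    ultimately have "y \<in> ?Q" using y(1) by blast
    then show False using \<open>?Q = P\<close> y(2) by simp
  qed
  have "y \<in> P \<or> inv y \<in> P" if y: "y \<in> carrier G" for y
  proof (rule ccontr)
    assume "\<not> ?thesis"
    then obtain p q m n where p: "p \<in> P" "p \<otimes> (y \<curlywedge> \<one>) [^] (m::nat) \<preceq> g"
      and q: "q \<in> P" "q \<otimes> (inv y \<curlywedge> \<one>) [^] (n::nat) \<preceq> g"
      using adj y inv_closed by metis
    let ?a = "y \<curlywedge> \<one>" and ?b = "inv y \<curlywedge> \<one>"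
    have pq: "p \<in> carrier G" "q \<in> carrier G" using p q P lg_coneD(1) by blast+
    have ab: "?a \<in> carrier G" "?b \<in> carrier G" "?a \<preceq> \<one>" "?b \<preceq> \<one>"
      using y meet_lower2 by auto
    have "(p \<curlywedge> q) \<otimes> ?a [^] m \<preceq> g"
      using p pq ab g le_trans [of "(p \<curlywedge> q) \<otimes> ?a [^] m" "p \<otimes> ?a [^] m" g]
      by (simp add: mult_right_le_iff meet_lower1)
    then have a: "?a [^] m \<preceq> inv (p \<curlywedge> q) \<otimes> g" using pq g ab by (simp add: le_diff_iff)
    have "(p \<curlywedge> q) \<otimes> ?b [^] n \<preceq> g"
      using q pq ab g le_trans [of "(p \<curlywedge> q) \<otimes> ?b [^] n" "q \<otimes> ?b [^] n" g]
      by (simp add: mult_right_le_iff meet_lower2)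
    then have b: "?b [^] n \<preceq> inv (p \<curlywedge> q) \<otimes> g" using pq g ab by (simp add: le_diff_iff)
    \<comment> \<open>Disjointness is raised to powers in two rounds: here for a power of
      \<open>?a\<close> against \<open>?b\<close>, then for a power of \<open>?b\<close> against
      that power of \<open>?a\<close>. This leaves \<open>p \<curlywedge> q\<close> below
      \<open>g\<close>, which forces \<open>g\<close> into \<open>P\<close>.\<close>
    have 1: "\<one> \<preceq> w" if "w \<in> carrier G" "?a [^] m \<preceq> w" "?b \<preceq> w" for w
      using disjoint_pow [of ?a ?b w m] disjoint_parts y ab that by blast
    have "\<one> \<preceq> inv (p \<curlywedge> q) \<otimes> g"
    proof (rule disjoint_pow [of ?b "?a [^] m" _ n])
      show "?a [^] m \<preceq> \<one>" using ab pow_le_one by blast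
    qed (use ab a b pq g 1 in auto)
    then have "p \<curlywedge> q \<preceq> g" using pq g by (simp add: one_le_diff_iff)
    then show False using p q P g lg_coneD(4) lg_cone_upward by blast
  qed
  then show ?thesis using P by blast
qed

end

section \<open>Integer points of total cones of linear forms\<close>

text \<open>The predicate \<open>s\<close> marks the bounds that must be strict. The midpoint of the
  greatest lower and the least upper bound works: a strict bound on one side is strictly separated
  from the extreme bound on the other.\<close>

lemma between_bounds:
  fixes f :: "'b \<Rightarrow> rat"
  assumes "finite L" "finite U"
    and le: "\<And>a b. a \<in> L \<Longrightarrow> b \<in> U \<Longrightarrow> f a \<le> f b"
    and less: "\<And>a b. a \<in> L \<Longrightarrow> b \<in> U \<Longrightarrow> s a \<or> s b \<Longrightarrow> f a < f b"
  obtains y where "\<And>a. a \<in> L \<Longrightarrow> f a \<le> y" "\<And>a. a \<in> L \<Longrightarrow> s a \<Longrightarrow> f a < y"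
    "\<And>b. b \<in> U \<Longrightarrow> y \<le> f b" "\<And>b. b \<in> U \<Longrightarrow> s b \<Longrightarrow> y < f b"
proof -
  \<comment> \<open>If one side is empty, its bound is placed at distance 1 from the other one, so
    that strict bounds stay strict at the midpoint.\<close>
  define l where "l = (if L = {} then (if U = {} then 0 else Min (f ` U) - 1) else Max (f ` L))"
  define h where "h = (if U = {} then l + 1 else Min (f ` U))"
  have L: "f a \<le> l" if "a \<in> L" for a
    using that \<open>finite L\<close> by (auto simp: l_def)
  have U: "h \<le> f b" if "b \<in> U" for b
    using that \<open>finite U\<close> by (auto simp: h_def)
  have L': "f a \<le> h" "s a \<Longrightarrow> f a < h" if "a \<in> L" for a
    using that L [OF that] le less \<open>finite U\<close> by (auto simp: h_def)
  have U': "l \<le> f b" "s b \<Longrightarrow> l < f b" if "b \<in> U" for b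
  proof -
    have "Min (f ` U) \<le> f b"
      using that \<open>finite U\<close> by (intro Min_le) auto
    then have "Min (f ` U) - 1 < f b" by linarith
    then show "l \<le> f b" "s b \<Longrightarrow> l < f b"
      using that le less \<open>finite L\<close> by (auto simp: l_def)
  qed
  show ?thesis
  proof
    fix a assume "a \<in> L"
    then show "f a \<le> (l + h) / 2" "s a \<Longrightarrow> f a < (l + h) / 2"
      using L [of a] L' [of a] by auto
  next
    fix b assume "b \<in> U"
    then show "(l + h) / 2 \<le> f b" "s b \<Longrightarrow> (l + h) / 2 < f b"
      using U [of b] U' [of b] by auto
  qed
qed

text \<open>The nonnegative elements of a total preorder on the group of integer vectors. A form is
  strictly positive for it exactly if its negative lies outside the cone; this is the strictness
  that the models below have to realise.\<close>

definition total_cone :: "('v \<Rightarrow> int) set \<Rightarrow> bool" where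
  "total_cone C \<longleftrightarrow> (\<forall>a\<in>C. \<forall>b\<in>C. (\<lambda>i. a i + b i) \<in> C) \<and> (\<forall>a. a \<in> C \<or> (\<lambda>i. - a i) \<in> C)"

lemma total_cone_add: "total_cone C \<Longrightarrow> a \<in> C \<Longrightarrow> b \<in> C \<Longrightarrow> (\<lambda>i. a i + b i) \<in> C"
  by (auto simp: total_cone_def)

lemma total_cone_total: "total_cone C \<Longrightarrow> a \<notin> C \<Longrightarrow> (\<lambda>i. - a i) \<in> C"
  by (auto simp: total_cone_def)

lemma total_cone_zero: "total_cone C \<Longrightarrow> (\<lambda>i. 0) \<in> C"
  by (auto simp: total_cone_def dest: spec [of _ "\<lambda>i. 0"])

lemma total_cone_scale:
  assumes "total_cone C" "a \<in> C" "0 \<le> k"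
  shows "(\<lambda>i. k * a i) \<in> C"
proof -
  have "(\<lambda>i. int n * a i) \<in> C" for n
  proof (induction n)
    case (Suc n)
    show ?case
      using total_cone_add [OF assms(1) assms(2) Suc] by (simp add: algebra_simps)
  qed (simp add: total_cone_zero assms)
  from this [of "nat k"] show ?thesis using assms(3) by simp
qed

text \<open>Totality makes the cone closed under division: if \<open>-a\<close> were the only one of
  the two in it, adding \<open>k - 1\<close> copies of \<open>-a\<close> to \<open>k * a\<close>
  would give \<open>a\<close> after all.\<close>

lemma total_cone_root:
  assumes C: "total_cone C" and "0 < k" "(\<lambda>i. k * a i) \<in> C"
  shows "a \<in> C"
proof (rule ccontr)
  assume a: "a \<notin> C"
  then have "(\<lambda>i. (k - 1) * - a i) \<in> C"
    using assms by (intro total_cone_scale total_cone_total) auto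
  from total_cone_add [OF C assms(3) this] have "(\<lambda>i. a i) \<in> C"
    by (simp add: algebra_simps)
  then show False using a by simp
qed

definition lin_eval :: "'v set \<Rightarrow> ('v \<Rightarrow> int) \<Rightarrow> ('v \<Rightarrow> rat) \<Rightarrow> rat" where
  "lin_eval S a p = (\<Sum>i\<in>S. of_int (a i) * p i)"

text \<open>Fourier--Motzkin elimination: every lower bound for the eliminated variable is combined
  with every upper bound, and these combinations lie in the cone again.\<close>

lemma total_cone_finite_model:
  assumes C: "total_cone C" and "finite S"
    and "finite A" "A \<subseteq> C" "\<And>a i. a \<in> A \<Longrightarrow> i \<notin> S \<Longrightarrow> a i = 0"
  shows "\<exists>p. \<forall>a\<in>A. 0 \<le> lin_eval S a p \<and> ((\<lambda>i. - a i) \<notin> C \<longrightarrow> 0 < lin_eval S a p)"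
  using assms(2-)
proof (induction S arbitrary: A rule: finite_induct)
  case empty
  then have "(\<lambda>i. - a i) \<in> C" if "a \<in> A" for a
  proof -
    have "(\<lambda>i. - a i) = (\<lambda>i. 0)" using empty.prems(3) [OF that] by (intro ext) simp
    then show ?thesis using total_cone_zero [OF C] by simp
  qed
  then show ?case by (auto simp: lin_eval_def)
next
  case (insert v S)
  define strict where "strict a \<longleftrightarrow> (\<lambda>i. - a i) \<notin> C" for a :: "'a \<Rightarrow> int"
  define L where "L = {a \<in> A. a v > 0}"
  define U where "U = {a \<in> A. a v < 0}"
  define Z where "Z = {a \<in> A. a v = 0}"
  \<comment> \<open>Both weights are positive integers, chosen so that the coefficient at
    \<open>v\<close> cancels; no division takes a form out of the integer cone.\<close>
  define comb where "comb a b = (\<lambda>i. (- b v) * a i + a v * b i)" for a b :: "'a \<Rightarrow> int"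
  have "finite L" "finite U" "finite Z" and A: "A = L \<union> U \<union> Z"
    using insert.prems by (auto simp: L_def U_def Z_def)
  have LC: "a \<in> C" "a v > 0" if "a \<in> L" for a using that insert.prems by (auto simp: L_def)
  have UC: "a \<in> C" "a v < 0" if "a \<in> U" for a using that insert.prems by (auto simp: U_def)
  define A' where "A' = Z \<union> (\<lambda>(a, b). comb a b) ` (L \<times> U)"
  have combC: "comb a b \<in> C" if "a \<in> L" "b \<in> U" for a b
    unfolding comb_def
    using LC [OF that(1)] UC [OF that(2)]
      total_cone_add [OF C total_cone_scale [OF C, of a "- b v"] total_cone_scale [OF C, of b "a v"]]
    by simp
  have "\<exists>p. \<forall>a\<in>A'. 0 \<le> lin_eval S a p \<and> ((\<lambda>i. - a i) \<notin> C \<longrightarrow> 0 < lin_eval S a p)"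
  proof (rule insert.IH)
    show "finite A'" using \<open>finite L\<close> \<open>finite U\<close> \<open>finite Z\<close> by (auto simp: A'_def)
    show "A' \<subseteq> C" using combC insert.prems by (auto simp: A'_def Z_def)
    show "a i = 0" if "a \<in> A'" "i \<notin> S" for a i
    proof (cases "i = v")
      case False
      then have zero: "b i = 0" if "b \<in> A" for b using that \<open>i \<notin> S\<close> insert.prems(3) by simp
      from \<open>a \<in> A'\<close> consider "a \<in> A" | b c where "b \<in> A" "c \<in> A" "a = comb b c"
        by (auto simp: A'_def Z_def L_def U_def)
      then show ?thesis by cases (simp_all add: comb_def zero)
    qed (use that in \<open>auto simp: A'_def Z_def comb_def\<close>)
  qed
  then obtain p where p: "\<And>a. a \<in> A' \<Longrightarrow> 0 \<le> lin_eval S a p"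
    "\<And>a. a \<in> A' \<Longrightarrow> strict a \<Longrightarrow> 0 < lin_eval S a p" by (auto simp: strict_def)
  \<comment> \<open>The bound that the form \<open>a\<close> puts on the value of \<open>v\<close>
    once the other variables take the values \<open>p\<close>.\<close>
  define f where "f a = - lin_eval S a p / of_int (a v)" for a
  have comb_eval: "lin_eval S (comb a b) p = of_int (a v) * of_int (- b v) * (f b - f a)"
    if "a \<in> L" "b \<in> U" for a b
  proof -
    have "lin_eval S (comb a b) p
        = of_int (- b v) * lin_eval S a p + of_int (a v) * lin_eval S b p"
      by (simp add: lin_eval_def comb_def sum.distrib sum_distrib_left algebra_simps sum_subtractf sum_negf)
    moreover have "lin_eval S a p = - f a * of_int (a v)" "lin_eval S b p = - f b * of_int (b v)"
      using LC(2) [OF that(1)] UC(2) [OF that(2)] by (simp_all add: f_def)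
    ultimately show ?thesis by (simp add: algebra_simps)
  qed
  have pos: "0 < of_int (a v) * (of_int (- b v) :: rat)" if "a \<in> L" "b \<in> U" for a b
    using LC(2) [OF that(1)] UC(2) [OF that(2)] by (simp add: mult_pos_neg)
  have zero_le_mult_pos: "0 \<le> x" if "0 \<le> k * x" "0 < k" for k x :: rat
    using that by (simp add: zero_le_mult_iff)
  have le: "f a \<le> f b" if "a \<in> L" "b \<in> U" for a b
  proof -
    have "0 \<le> lin_eval S (comb a b) p" using that p by (auto simp: A'_def)
    then show ?thesis
      using zero_le_mult_pos [OF _ pos [OF that], of "f b - f a"] by (simp only: comb_eval [OF that]) simp
  qed
  have less: "f a < f b" if "a \<in> L" "b \<in> U" "strict a \<or> strict b" for a b
  proof -
    \<comment> \<open>Suppose the negative of the combination lies in \<open>C\<close>. Adding back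
      one of its two summands leaves a positive multiple of the negative of the other form, so
      neither \<open>a\<close> nor \<open>b\<close> is strict.\<close>
    have "strict (comb a b)"
    proof (rule ccontr)
      assume "\<not> strict (comb a b)"
      then have neg: "(\<lambda>i. - comb a b i) \<in> C" by (simp add: strict_def)
      have "(\<lambda>i. (- b v) * - a i) \<in> C"
        using total_cone_add [OF C neg total_cone_scale [OF C, of b "a v"]] LC [OF that(1)] UC [OF that(2)]
        by (simp add: comb_def algebra_simps)
      moreover have "(\<lambda>i. a v * - b i) \<in> C"
        using total_cone_add [OF C neg total_cone_scale [OF C, of a "- b v"]] LC [OF that(1)] UC [OF that(2)]
        by (simp add: comb_def algebra_simps)
      ultimately have "(\<lambda>i. - a i) \<in> C" "(\<lambda>i. - b i) \<in> C"
        using LC [OF that(1)] UC [OF that(2)] total_cone_root [OF C, of "- b v" "\<lambda>i. - a i"]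
          total_cone_root [OF C, of "a v" "\<lambda>i. - b i"] by simp_all
      then show False using that by (simp add: strict_def)
    qed
    then have "0 < lin_eval S (comb a b) p" using that p by (auto simp: A'_def)
    then show ?thesis
      using zero_less_mult_pos [OF _ pos [OF that(1,2)], of "f b - f a"]
      by (simp only: comb_eval [OF that(1,2)]) simp
  qed
  obtain y where y: "\<And>a. a \<in> L \<Longrightarrow> f a \<le> y" "\<And>a. a \<in> L \<Longrightarrow> strict a \<Longrightarrow> f a < y"
    "\<And>b. b \<in> U \<Longrightarrow> y \<le> f b" "\<And>b. b \<in> U \<Longrightarrow> strict b \<Longrightarrow> y < f b"
    by (rule between_bounds [where s = strict and f = f, OF \<open>finite L\<close> \<open>finite U\<close>]) (use le less in blast)+
  have eval: "lin_eval (insert v S) a (p(v := y)) = of_int (a v) * y + lin_eval S a p" for a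
  proof -
    have "(\<Sum>i\<in>S. of_int (a i) * (p(v := y)) i) = (\<Sum>i\<in>S. of_int (a i) * p i)"
      using insert.hyps by (intro sum.cong) auto
    then show ?thesis using insert.hyps by (simp add: lin_eval_def)
  qed
  show ?case
  proof (intro exI [of _ "p(v := y)"] ballI)
    fix a assume "a \<in> A"
    then consider "a \<in> L" | "a \<in> U" | "a \<in> Z" using A by blast
    then show "0 \<le> lin_eval (insert v S) a (p(v := y)) \<and>
      ((\<lambda>i. - a i) \<notin> C \<longrightarrow> 0 < lin_eval (insert v S) a (p(v := y)))"
    proof cases
      case 1
      then show ?thesis
        using LC [OF 1] y(1,2) [OF 1] by (auto simp: eval strict_def f_def field_simps)
    next
      case 2
      then show ?thesis
        using UC [OF 2] y(3,4) [OF 2] by (auto simp: eval strict_def f_def field_simps)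
    next
      case 3
      then show ?thesis
        using p [of a] by (simp add: eval A'_def strict_def) (simp add: Z_def)
    qed
  qed
qed

lemma rat_common_denominator:
  fixes p :: "'v \<Rightarrow> rat"
  assumes "finite S"
  shows "\<exists>d>0::int. \<exists>q. \<forall>i\<in>S. of_int (q i) = of_int d * p i"
  using assms
proof (induction S rule: finite_induct)
  case empty
  show ?case by (intro exI [of _ 1]) auto
next
  case (insert v S)
  then obtain d q where d: "d > 0" "\<And>i. i \<in> S \<Longrightarrow> of_int (q i) = of_int d * p i" by blast
  obtain m n where "quotient_of (p v) = (m, n)" by fastforce
  then have n: "n > 0" "p v = of_int m / of_int n"
    using quotient_of_denom_pos quotient_of_div by blast+
  show ?case
  proof (intro exI [of _ "d * n"] conjI exI [of _ "(\<lambda>i. n * q i)(v := d * m)"] ballI)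
    fix i assume "i \<in> insert v S"
    then show "of_int (((\<lambda>i. n * q i)(v := d * m)) i) = of_int (d * n) * p i"
      using d(2) n by (cases "i = v") auto
  qed (use d n in auto)
qed

text \<open>The forms are homogeneous, so multiplying a rational solution by a common denominator
  preserves all signs.\<close>

lemma total_cone_finite_model_int:
  assumes "total_cone C" "finite S" "finite A" "A \<subseteq> C" "\<And>a i. a \<in> A \<Longrightarrow> i \<notin> S \<Longrightarrow> a i = 0"
  obtains q :: "'v \<Rightarrow> int" where "\<And>a. a \<in> A \<Longrightarrow> 0 \<le> (\<Sum>i\<in>S. a i * q i)"
    "\<And>a. a \<in> A \<Longrightarrow> (\<lambda>i. - a i) \<notin> C \<Longrightarrow> 0 < (\<Sum>i\<in>S. a i * q i)"
proof -
  obtain p where p: "\<And>a. a \<in> A \<Longrightarrow> 0 \<le> lin_eval S a p"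
    "\<And>a. a \<in> A \<Longrightarrow> (\<lambda>i. - a i) \<notin> C \<Longrightarrow> 0 < lin_eval S a p"
    using total_cone_finite_model [OF assms(1-4)] assms(5) by blast
  obtain d q where d: "d > 0" "\<And>i. i \<in> S \<Longrightarrow> of_int (q i) = of_int d * p i"
    using rat_common_denominator [OF \<open>finite S\<close>] by blast
  have eq: "rat_of_int (\<Sum>i\<in>S. a i * q i) = of_int d * lin_eval S a p" for a
    using d(2) by (simp add: lin_eval_def sum_distrib_left algebra_simps)
  have "0 \<le> (\<Sum>i\<in>S. a i * q i) \<longleftrightarrow> 0 \<le> lin_eval S a p"
    "0 < (\<Sum>i\<in>S. a i * q i) \<longleftrightarrow> 0 < lin_eval S a p" for a
    using d(1) eq [of a] zero_le_mult_iff [of "rat_of_int d" "lin_eval S a p"]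
      zero_less_mult_iff [of "rat_of_int d" "lin_eval S a p"]
      of_int_0_le_iff [where 'a = rat, of "\<Sum>i\<in>S. a i * q i"]
      of_int_0_less_iff [where 'a = rat, of "\<Sum>i\<in>S. a i * q i"]
    by (simp_all del: of_int_0_le_iff of_int_0_less_iff of_int_sum of_int_mult)
  then show ?thesis using p that by metis
qed

section \<open>Terms and their linearisation\<close>

text \<open>Zero is expressed as x - x and meets by de Morgan. The unit is an ordinary variable, so
  that its value at an integer point can act as the denominator of that point.\<close>

datatype (term_vars: 'v) lg_term =
  Var 'v | Neg "'v lg_term" | Add "'v lg_term" "'v lg_term" | Max "'v lg_term" "'v lg_term"

lemma finite_term_vars [simp]: "finite (term_vars t)"
  by (induction t) auto

primrec int_eval :: "('v \<Rightarrow> int) \<Rightarrow> 'v lg_term \<Rightarrow> int" where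
  "int_eval q (Var x) = q x"
| "int_eval q (Neg t) = - int_eval q t"
| "int_eval q (Add s t) = int_eval q s + int_eval q t"
| "int_eval q (Max s t) = max (int_eval q s) (int_eval q t)"

context unital_lgroup
begin

primrec eval :: "'a lg_term \<Rightarrow> 'a" where
  "eval (Var x) = x"
| "eval (Neg t) = inv (eval t)"
| "eval (Add s t) = eval s \<otimes> eval t"
| "eval (Max s t) = eval s \<curlyvee> eval t"

lemma eval_closed [simp]: "term_vars t \<subseteq> carrier G \<Longrightarrow> eval t \<in> carrier G"
  by (induction t) auto

text \<open>One fixed choice per element: all relators then put the same bound on a shared variable,
  and point sets can only shrink when variables and equations are added.\<close>

definition unit_multiplier :: "'a \<Rightarrow> nat" where
  "unit_multiplier x = (SOME n. x \<preceq> \<u> [^] n \<and> inv x \<preceq> \<u> [^] n)"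

lemma unit_multiplier:
  assumes "x \<in> carrier G"
  shows "x \<preceq> \<u> [^] unit_multiplier x" "inv x \<preceq> \<u> [^] unit_multiplier x"
  using someI_ex [OF unit_bound2 [OF assms]] by (auto simp: unit_multiplier_def)

definition lin_comb :: "'a set \<Rightarrow> ('a \<Rightarrow> int) \<Rightarrow> 'a" where
  "lin_comb S a = finprod G (\<lambda>i. i [^] a i) S"

lemma lin_comb_closed [simp]: "S \<subseteq> carrier G \<Longrightarrow> lin_comb S a \<in> carrier G"
  by (auto simp: lin_comb_def intro!: finprod_closed)

lemma lin_comb_zero [simp]: "lin_comb S (\<lambda>i. 0) = \<one>"
  by (simp add: lin_comb_def)

lemma lin_comb_add:
  assumes "S \<subseteq> carrier G"
  shows "lin_comb S (\<lambda>i. a i + b i) = lin_comb S a \<otimes> lin_comb S b"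
proof -
  have "lin_comb S (\<lambda>i. a i + b i) = finprod G (\<lambda>i. i [^] a i \<otimes> i [^] b i) S"
    unfolding lin_comb_def using assms by (intro finprod_cong') (auto simp: int_pow_mult)
  also have "\<dots> = lin_comb S a \<otimes> lin_comb S b"
    unfolding lin_comb_def using assms by (intro finprod_multf) auto
  finally show ?thesis .
qed

lemma lin_comb_neg:
  assumes "S \<subseteq> carrier G"
  shows "lin_comb S (\<lambda>i. - a i) = inv (lin_comb S a)"
proof -
  have "lin_comb S (\<lambda>i. - a i) \<otimes> lin_comb S a = \<one>"
    using lin_comb_add [OF assms, of "\<lambda>i. - a i" a] by simp
  then show ?thesis using assms by (simp add: inv_equality)
qed

lemma lin_comb_scale:
  assumes "S \<subseteq> carrier G"
  shows "lin_comb S (\<lambda>i. int n * a i) = lin_comb S a [^] n"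
proof (induction n)
  case (Suc n)
  have "lin_comb S (\<lambda>i. int (Suc n) * a i) = lin_comb S (\<lambda>i. int n * a i + a i)"
    by (simp add: algebra_simps)
  then show ?case using Suc lin_comb_add [OF assms] by simp
qed simp

lemma lin_comb_single:
  assumes "finite S" "S \<subseteq> carrier G" "x \<in> S"
  shows "lin_comb S (\<lambda>i. if i = x then 1 else 0) = x"
proof -
  have "lin_comb S (\<lambda>i. if i = x then 1 else 0) = finprod G (\<lambda>i. if x = i then i else \<one>) S"
    unfolding lin_comb_def using assms by (intro finprod_cong') (auto simp: int_pow_1)
  also have "\<dots> = x"
    using assms by (intro finprod_singleton) auto
  finally show ?thesis .
qed

end

section \<open>The total preorder of a prime cone, and terms as linear forms modulo it\<close>

locale prime_cone = unital_lgroup +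
  fixes P
  assumes cone: "lg_cone P" and prime: "y \<in> carrier G \<Longrightarrow> y \<in> P \<or> inv y \<in> P"
begin

definition leP (infix "\<sqsubseteq>\<^sub>P" 50) where "x \<sqsubseteq>\<^sub>P y \<longleftrightarrow> inv x \<otimes> y \<in> P"

lemma leP_mono: "x \<preceq> y \<Longrightarrow> x \<in> carrier G \<Longrightarrow> y \<in> carrier G \<Longrightarrow> x \<sqsubseteq>\<^sub>P y"
  using lg_coneD(2) [OF cone, of "inv x \<otimes> y"] by (simp add: leP_def one_le_diff_iff)

lemma leP_trans:
  assumes "x \<sqsubseteq>\<^sub>P y" "y \<sqsubseteq>\<^sub>P z" "x \<in> carrier G" "y \<in> carrier G" "z \<in> carrier G"
  shows "x \<sqsubseteq>\<^sub>P z"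
proof -
  have "(inv x \<otimes> y) \<otimes> (inv y \<otimes> z) \<in> P" using assms lg_coneD(3) [OF cone] by (simp add: leP_def)
  moreover have "y \<otimes> (inv y \<otimes> z) = z" using assms m_assoc [of y "inv y" z] by simp
  then have "(inv x \<otimes> y) \<otimes> (inv y \<otimes> z) = inv x \<otimes> z"
    using assms m_assoc [of "inv x" y "inv y \<otimes> z"] by simp
  ultimately show ?thesis using assms by (simp add: leP_def)
qed

lemma leP_mult:
  assumes "x \<sqsubseteq>\<^sub>P y" "z \<sqsubseteq>\<^sub>P w" "x \<in> carrier G" "y \<in> carrier G" "z \<in> carrier G" "w \<in> carrier G"
  shows "x \<otimes> z \<sqsubseteq>\<^sub>P y \<otimes> w"
proof -
  have "(inv x \<otimes> y) \<otimes> (inv z \<otimes> w) \<in> P" using assms lg_coneD(3) [OF cone] by (simp add: leP_def)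
  moreover have "(inv x \<otimes> y) \<otimes> (inv z \<otimes> w) = inv (x \<otimes> z) \<otimes> (y \<otimes> w)"
    using assms by (simp add: m_ac inv_mult)
  ultimately show ?thesis by (simp add: leP_def)
qed

lemma leP_inv: "x \<sqsubseteq>\<^sub>P y \<Longrightarrow> x \<in> carrier G \<Longrightarrow> y \<in> carrier G \<Longrightarrow> inv y \<sqsubseteq>\<^sub>P inv x"
  by (simp add: leP_def m_comm)

lemma leP_total: "x \<in> carrier G \<Longrightarrow> y \<in> carrier G \<Longrightarrow> x \<sqsubseteq>\<^sub>P y \<or> y \<sqsubseteq>\<^sub>P x"
  using prime [of "inv x \<otimes> y"] by (simp add: leP_def inv_mult m_comm)

text \<open>Additively, the meet of y - x and 0 is in \<open>P\<close> because \<open>P\<close> is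
  closed under meets. Both x and y are at most y minus this meet, hence so is their join, and y
  minus the join lies above an element of \<open>P\<close>.\<close>

lemma join_leP:
  assumes "x \<sqsubseteq>\<^sub>P y" "x \<in> carrier G" "y \<in> carrier G"
  shows "x \<curlyvee> y \<sqsubseteq>\<^sub>P y"
proof -
  let ?m = "(inv x \<otimes> y) \<curlywedge> \<one>"
  have "?m \<in> P"
    using assms lg_coneD(2,4) [OF cone] by (simp add: leP_def)
  moreover have "x \<preceq> inv ?m \<otimes> y"
    using assms le_diff_iff [of x y ?m] le_diff_iff [of ?m y x] m_comm [of x ?m]
      meet_lower1 [of "inv x \<otimes> y" \<one>] by simp
  moreover have "y \<preceq> inv ?m \<otimes> y"
    using assms le_diff_iff [of y y ?m] mult_right_le_iff [of ?m \<one> y]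
      meet_lower2 [of "inv x \<otimes> y" \<one>] by simp
  ultimately have "x \<curlyvee> y \<preceq> inv ?m \<otimes> y"
    using assms join_least by simp
  then have "?m \<preceq> inv (x \<curlyvee> y) \<otimes> y"
    using assms le_diff_iff [of "x \<curlyvee> y" y ?m] le_diff_iff [of ?m y "x \<curlyvee> y"]
      m_comm [of "x \<curlyvee> y" ?m] by simp
  then show ?thesis
    using lg_cone_upward [OF cone \<open>?m \<in> P\<close>] assms by (simp add: leP_def)
qed

definition eqP (infix "\<approx>\<^sub>P" 50) where "x \<approx>\<^sub>P y \<longleftrightarrow> x \<sqsubseteq>\<^sub>P y \<and> y \<sqsubseteq>\<^sub>P x"

lemma join_eqP:
  assumes "x \<approx>\<^sub>P x'" "y \<approx>\<^sub>P y'" "x' \<sqsubseteq>\<^sub>P y'"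
    and "x \<in> carrier G" "y \<in> carrier G" "x' \<in> carrier G" "y' \<in> carrier G"
  shows "x \<curlyvee> y \<approx>\<^sub>P y'" "y \<curlyvee> x \<approx>\<^sub>P y'"
proof -
  have "x \<sqsubseteq>\<^sub>P y" using assms leP_trans [of x x' y'] leP_trans [of x y' y] by (simp add: eqP_def)
  then have "x \<curlyvee> y \<sqsubseteq>\<^sub>P y" using assms join_leP by simp
  then have "x \<curlyvee> y \<sqsubseteq>\<^sub>P y'" using assms leP_trans [of "x \<curlyvee> y" y y'] by (simp add: eqP_def)
  moreover have "y \<sqsubseteq>\<^sub>P x \<curlyvee> y" using assms by (simp add: leP_mono join_upper2)
  then have "y' \<sqsubseteq>\<^sub>P x \<curlyvee> y" using assms leP_trans [of y' y "x \<curlyvee> y"] by (simp add: eqP_def)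
  ultimately show "x \<curlyvee> y \<approx>\<^sub>P y'" by (simp add: eqP_def)
  moreover have "x \<curlyvee> y = y \<curlyvee> x"
    using assms by (intro join_eqI) (auto intro: join_upper1 join_upper2 join_least)
  ultimately show "y \<curlyvee> x \<approx>\<^sub>P y'" by simp
qed

definition form_cone :: "'a set \<Rightarrow> ('a \<Rightarrow> int) set" where
  "form_cone S = {a. lin_comb S a \<in> P}"

lemma total_form_cone: "S \<subseteq> carrier G \<Longrightarrow> total_cone (form_cone S)"
  using prime lg_coneD(3) [OF cone]
  by (simp add: total_cone_def form_cone_def lin_comb_add lin_comb_neg)

lemma form_cone_iff_leP:
  assumes "S \<subseteq> carrier G"
  shows "(\<lambda>i. b i - a i) \<in> form_cone S \<longleftrightarrow> lin_comb S a \<sqsubseteq>\<^sub>P lin_comb S b"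
  using lin_comb_add [OF assms, of "\<lambda>i. - a i" b] assms
  by (simp add: form_cone_def leP_def lin_comb_neg)

definition form_value :: "'a set \<Rightarrow> ('a \<Rightarrow> int) \<Rightarrow> ('a \<Rightarrow> int) \<Rightarrow> int" where
  "form_value S a q = (\<Sum>i\<in>S. a i * q i)"

text \<open>Modulo the prime cone every term is linear, and it is given by the same linear form at all
  integer points that satisfy finitely many inequalities from the cone.\<close>

lemma eval_linear:
  assumes S: "finite S" "S \<subseteq> carrier G"
  shows "term_vars t \<subseteq> S \<Longrightarrow>
    \<exists>a A. finite A \<and> A \<subseteq> form_cone S \<and> (\<forall>b\<in>insert a A. \<forall>i. i \<notin> S \<longrightarrow> b i = 0) \<and>
      eval t \<approx>\<^sub>P lin_comb S a \<and>
      (\<forall>q. (\<forall>b\<in>A. 0 \<le> form_value S b q) \<longrightarrow> int_eval q t = form_value S a q)"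
proof (induction t)
  case (Var x)
  then have "x \<in> S" "x \<in> carrier G" using S by auto
  let ?a = "\<lambda>i. if i = x then 1 else 0 :: int"
  have "(\<Sum>i\<in>S. ?a i * q i) = q x" for q :: "'a \<Rightarrow> int"
  proof -
    have "(\<Sum>i\<in>S. ?a i * q i) = (\<Sum>i\<in>S. if i = x then q i else 0)" by (intro sum.cong) auto
    then show ?thesis using \<open>finite S\<close> \<open>x \<in> S\<close> by simp
  qed
  then show ?case
    using \<open>x \<in> S\<close> \<open>x \<in> carrier G\<close> S
    by (intro exI [of _ ?a] exI [of _ "{}"])
      (auto simp: lin_comb_single eqP_def leP_mono form_value_def)
next
  case (Neg t)
  then obtain a A where A: "finite A" "A \<subseteq> form_cone S" "\<forall>b\<in>insert a A. \<forall>i. i \<notin> S \<longrightarrow> b i = 0"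
    "eval t \<approx>\<^sub>P lin_comb S a"
    "\<forall>q. (\<forall>b\<in>A. 0 \<le> form_value S b q) \<longrightarrow> int_eval q t = form_value S a q" by auto
  have t: "eval t \<in> carrier G" using Neg.prems S by (intro eval_closed) auto
  have "eval (Neg t) \<approx>\<^sub>P lin_comb S (\<lambda>i. - a i)"
    using A(4) S t by (simp add: eqP_def lin_comb_neg leP_inv)
  moreover have "form_value S (\<lambda>i. - a i) q = - form_value S a q" for q
    by (simp add: form_value_def sum_negf)
  ultimately show ?case
    using A by (intro exI [of _ "\<lambda>i. - a i"] exI [of _ A]) auto
next
  case (Add s t)
  then obtain a A where A: "finite A" "A \<subseteq> form_cone S" "\<forall>b\<in>insert a A. \<forall>i. i \<notin> S \<longrightarrow> b i = 0"
    "eval s \<approx>\<^sub>P lin_comb S a"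
    "\<forall>q. (\<forall>b\<in>A. 0 \<le> form_value S b q) \<longrightarrow> int_eval q s = form_value S a q" by auto
  from Add obtain b B where B: "finite B" "B \<subseteq> form_cone S" "\<forall>c\<in>insert b B. \<forall>i. i \<notin> S \<longrightarrow> c i = 0"
    "eval t \<approx>\<^sub>P lin_comb S b"
    "\<forall>q. (\<forall>b\<in>B. 0 \<le> form_value S b q) \<longrightarrow> int_eval q t = form_value S b q" by auto
  have "eval s \<in> carrier G" "eval t \<in> carrier G"
    using Add.prems S by (auto intro!: eval_closed)
  then have "eval (Add s t) \<approx>\<^sub>P lin_comb S (\<lambda>i. a i + b i)"
    using A(4) B(4) S by (simp add: eqP_def lin_comb_add leP_mult)
  moreover have "form_value S (\<lambda>i. a i + b i) q = form_value S a q + form_value S b q" for q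
    by (simp add: form_value_def sum.distrib algebra_simps)
  ultimately show ?case
    using A B by (intro exI [of _ "\<lambda>i. a i + b i"] exI [of _ "A \<union> B"]) auto
next
  case (Max s t)
  then obtain a A where A: "finite A" "A \<subseteq> form_cone S" "\<forall>b\<in>insert a A. \<forall>i. i \<notin> S \<longrightarrow> b i = 0"
    "eval s \<approx>\<^sub>P lin_comb S a"
    "\<forall>q. (\<forall>b\<in>A. 0 \<le> form_value S b q) \<longrightarrow> int_eval q s = form_value S a q" by auto
  from Max obtain b B where B: "finite B" "B \<subseteq> form_cone S" "\<forall>c\<in>insert b B. \<forall>i. i \<notin> S \<longrightarrow> c i = 0"
    "eval t \<approx>\<^sub>P lin_comb S b"
    "\<forall>q. (\<forall>b\<in>B. 0 \<le> form_value S b q) \<longrightarrow> int_eval q t = form_value S b q" by auto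
  have st: "eval s \<in> carrier G" "eval t \<in> carrier G"
    using Max.prems S by (auto intro!: eval_closed)
  have diff: "form_value S (\<lambda>i. a i - b i) q = form_value S a q - form_value S b q" for a b q
    by (simp add: form_value_def sum_subtractf algebra_simps)
  \<comment> \<open>The preorder decides which argument is the maximum modulo \<open>P\<close>. The
    difference of the two forms is added to the list of inequalities, so that every admissible
    integer point decides in the same way.\<close>
  have "lin_comb S a \<sqsubseteq>\<^sub>P lin_comb S b \<or> lin_comb S b \<sqsubseteq>\<^sub>P lin_comb S a"
    using S by (simp add: leP_total)
  then show ?case
  proof
    assume le: "lin_comb S a \<sqsubseteq>\<^sub>P lin_comb S b"
    have "eval (Max s t) \<approx>\<^sub>P lin_comb S b"
      using join_eqP(1) [OF A(4) B(4) le] st S by simp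
    moreover have "(\<lambda>i. b i - a i) \<in> form_cone S" using le S by (simp add: form_cone_iff_leP)
    ultimately show ?thesis
      using A B by (intro exI [of _ b] exI [of _ "insert (\<lambda>i. b i - a i) (A \<union> B)"]) (auto simp: diff)
  next
    assume le: "lin_comb S b \<sqsubseteq>\<^sub>P lin_comb S a"
    have "eval (Max s t) \<approx>\<^sub>P lin_comb S a"
      using join_eqP(2) [OF B(4) A(4) le] st S by simp
    moreover have "(\<lambda>i. a i - b i) \<in> form_cone S" using le S by (simp add: form_cone_iff_leP)
    ultimately show ?thesis
      using A B by (intro exI [of _ a] exI [of _ "insert (\<lambda>i. a i - b i) (A \<union> B)"]) (auto simp: diff)
  qed
qed

end

section \<open>Integer points that separate the values of terms\<close>

context unital_lgroup
begin

text \<open>A point \<open>q\<close> stands for the rational point with coordinates q x / q u, u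
  being the unit. The bounds ensure that multiples of the unit dominate every term function on these
  points.\<close>

definition int_points :: "'a set \<Rightarrow> 'a lg_term \<Rightarrow> ('a \<Rightarrow> int) set" where
  "int_points S t = {q. 0 < q \<u> \<and> (\<forall>x\<in>S. \<bar>q x\<bar> \<le> int (unit_multiplier x) * q \<u>) \<and> int_eval q t = 0}"

end

context prime_cone
begin

text \<open>Every requirement on the point is a sign condition on a form of the cone. The lists
  \<open>A\<close> and \<open>B\<close> make the terms agree with their forms; \<open>t\<close> is
  zero modulo \<open>P\<close>, so its form and the negative of it are both in the cone;
  \<open>s\<close> is not, so its form is strict with one of the two signs; the unit is strict as
  \<open>P\<close> is proper.\<close>

lemma separating_point:
  assumes S: "finite S" "S \<subseteq> carrier G" "\<u> \<in> S"
    and t: "term_vars t \<subseteq> S" "eval t = \<one>"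
    and s: "term_vars s \<subseteq> S" "\<not> (eval s \<in> P \<and> inv (eval s) \<in> P)"
  shows "\<exists>q\<in>int_points S t. int_eval q s \<noteq> 0"
proof -
  have s_closed: "eval s \<in> carrier G" using S s by (intro eval_closed) auto
  obtain g where g: "g \<in> carrier G" "g \<notin> P" using s s_closed by auto
  obtain a A where A: "finite A" "A \<subseteq> form_cone S" "\<And>b i. b \<in> insert a A \<Longrightarrow> i \<notin> S \<Longrightarrow> b i = 0"
    "eval s \<approx>\<^sub>P lin_comb S a"
    "\<And>q. (\<forall>b\<in>A. 0 \<le> form_value S b q) \<Longrightarrow> int_eval q s = form_value S a q"
    using eval_linear [OF S(1,2) s(1)] by blast
  obtain b B where B: "finite B" "B \<subseteq> form_cone S" "\<And>c i. c \<in> insert b B \<Longrightarrow> i \<notin> S \<Longrightarrow> c i = 0"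
    "eval t \<approx>\<^sub>P lin_comb S b"
    "\<And>q. (\<forall>c\<in>B. 0 \<le> form_value S c q) \<Longrightarrow> int_eval q t = form_value S b q"
    using eval_linear [OF S(1,2) t(1)] by blast
  define e where "e x = (\<lambda>i. if i = x then 1 else 0 :: int)" for x :: 'a
  define neg where "neg a = (\<lambda>i. - a i)" for a :: "'a \<Rightarrow> int"
  \<comment> \<open>Nonnegativity of \<open>up x\<close> and \<open>lo x\<close> is the bound on the
    absolute value of \<open>q x\<close> in \<open>int_points\<close>. The shape \<open>+ -\<close>
    lets \<open>lin_comb_add\<close> and \<open>lin_comb_neg\<close> rewrite it.\<close>
  define up where "up x = (\<lambda>i. int (unit_multiplier x) * e \<u> i + - e x i)" for x
  define lo where "lo x = (\<lambda>i. int (unit_multiplier x) * e \<u> i + e x i)" for x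
  \<comment> \<open>Intersecting with the cone selects the signs of \<open>a\<close> that are
    nonnegative; \<open>b\<close> together with its negative forces \<open>t\<close> to vanish at
    the point.\<close>
  define F where "F = A \<union> B \<union> ({a, neg a} \<inter> form_cone S) \<union> {b, neg b} \<union> {e \<u>} \<union> up ` S \<union> lo ` S"
  have lin_e: "lin_comb S (e x) = x" if "x \<in> S" for x
    using that S lin_comb_single by (simp add: e_def)
  have b: "b \<in> form_cone S" "neg b \<in> form_cone S"
    using B(4) S(2) t(2) by (simp_all add: form_cone_def neg_def lin_comb_neg eqP_def leP_def)
  have not_both: "\<not> (a \<in> form_cone S \<and> neg a \<in> form_cone S)"
  proof
    assume "a \<in> form_cone S \<and> neg a \<in> form_cone S"
    then have "\<one> \<sqsubseteq>\<^sub>P lin_comb S a" "lin_comb S a \<sqsubseteq>\<^sub>P \<one>"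
      using S(2) by (simp_all add: form_cone_def neg_def lin_comb_neg leP_def)
    then have "\<one> \<sqsubseteq>\<^sub>P eval s" "eval s \<sqsubseteq>\<^sub>P \<one>"
      using A(4) leP_trans [of \<one> "lin_comb S a" "eval s"] leP_trans [of "eval s" "lin_comb S a" \<one>]
        S(2) s_closed by (simp_all add: eqP_def)
    then show False using s(2) s_closed by (simp add: leP_def)
  qed
  \<comment> \<open>If the negative of the unit were in \<open>P\<close>, so would be its multiples
    and everything above them, including the excluded element \<open>g\<close>.\<close>
  have unit_strict: "neg (e \<u>) \<notin> form_cone S"
  proof
    assume "neg (e \<u>) \<in> form_cone S"
    then have inv_u: "inv \<u> \<in> P" using lin_e [OF S(3)] S(2) by (simp add: form_cone_def neg_def lin_comb_neg)
    have pow: "inv \<u> [^] (n::nat) \<in> P" for n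
      by (induction n) (use inv_u lg_coneD(2,3) [OF cone] in auto)
    obtain n :: nat where "inv g \<preceq> \<u> [^] n" using unit_bound2 [OF g(1)] by blast
    then have "inv (\<u> [^] n) \<preceq> g"
      using g unit_closed inv_le_iff [of "\<u> [^] n" "inv g"] by simp
    then show False
      using lg_cone_upward [OF cone pow [of n]] g unit_closed by (simp add: nat_pow_inv)
  qed
  have unit_cone: "e \<u> \<in> form_cone S"
    using lin_e [OF S(3)] unit_closed unit_nonneg lg_coneD(2) [OF cone] by (simp add: form_cone_def)
  have bounds: "up x \<in> form_cone S" "lo x \<in> form_cone S" if "x \<in> S" for x
  proof -
    have x: "x \<in> carrier G" using that S by auto
    let ?m = "unit_multiplier x"
    have "lin_comb S (up x) = inv x \<otimes> \<u> [^] ?m" "lin_comb S (lo x) = inv (inv x) \<otimes> \<u> [^] ?m"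
      using S(2) x unit_closed lin_e [OF that] lin_e [OF S(3)]
      by (simp_all only: up_def lo_def lin_comb_add lin_comb_scale lin_comb_neg)
        (simp_all add: m_comm)
    moreover have "inv x \<otimes> \<u> [^] ?m \<in> P" "inv (inv x) \<otimes> \<u> [^] ?m \<in> P"
      using leP_mono [OF unit_multiplier(1) [OF x]] leP_mono [OF unit_multiplier(2) [OF x]] x unit_closed
      by (simp_all add: leP_def)
    ultimately show "up x \<in> form_cone S" "lo x \<in> form_cone S" by (simp_all add: form_cone_def)
  qed
  have F: "finite F" "F \<subseteq> form_cone S"
    using A(1,2) B(1,2) S(1) b unit_cone bounds by (auto simp: F_def)
  have supp: "c i = 0" if "c \<in> F" "i \<notin> S" for c i
  proof -
    from \<open>c \<in> F\<close> consider "c \<in> insert a A" | "c \<in> insert b B" | "c = neg a" | "c = neg b" | "c = e \<u>"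
      | x where "x \<in> S" "c = up x" | x where "x \<in> S" "c = lo x"
      unfolding F_def by blast
    then show ?thesis
    proof cases
      case 3 then show ?thesis using A(3) [of a i] that by (simp add: neg_def)
    next
      case 4 then show ?thesis using B(3) [of b i] that by (simp add: neg_def)
    next
      case 5 then show ?thesis using S(3) that by (auto simp: e_def)
    next
      case 6 then show ?thesis using S(3) that by (auto simp: e_def up_def)
    next
      case 7 then show ?thesis using S(3) that by (auto simp: e_def lo_def)
    qed (use A(3) B(3) that in auto)
  qed
  obtain q where q: "\<And>c. c \<in> F \<Longrightarrow> 0 \<le> form_value S c q"
    "\<And>c. c \<in> F \<Longrightarrow> neg c \<notin> form_cone S \<Longrightarrow> 0 < form_value S c q"
    by (rule total_cone_finite_model_int [OF total_form_cone [OF S(2)] S(1) F])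
      (auto simp: form_value_def neg_def dest: supp)
  have value_neg: "form_value S (neg c) q = - form_value S c q" for c
    by (simp add: form_value_def neg_def sum_negf)
  have value_e: "form_value S (e x) q = q x" if "x \<in> S" for x
  proof -
    have "form_value S (e x) q = (\<Sum>i\<in>S. if i = x then q i else 0)"
      unfolding form_value_def e_def by (intro sum.cong) auto
    then show ?thesis using S(1) that by simp
  qed
  have value_up: "form_value S (up x) q = int (unit_multiplier x) * q \<u> - q x"
    and value_lo: "form_value S (lo x) q = int (unit_multiplier x) * q \<u> + q x" if "x \<in> S" for x
  proof -
    have "form_value S (up x) q = int (unit_multiplier x) * form_value S (e \<u>) q - form_value S (e x) q"
      "form_value S (lo x) q = int (unit_multiplier x) * form_value S (e \<u>) q + form_value S (e x) q"
      by (simp_all add: form_value_def up_def lo_def sum.distrib sum_subtractf sum_distrib_left algebra_simps)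
    then show "form_value S (up x) q = int (unit_multiplier x) * q \<u> - q x"
      "form_value S (lo x) q = int (unit_multiplier x) * q \<u> + q x"
      using value_e [OF that] value_e [OF S(3)] by simp_all
  qed
  have "int_eval q s = form_value S a q" "int_eval q t = form_value S b q"
    using A(5) B(5) q(1) by (simp_all add: F_def)
  moreover have "form_value S a q \<noteq> 0"
  proof (cases "a \<in> form_cone S")
    case True
    then show ?thesis using not_both q(2) [of a] by (simp add: F_def)
  next
    case False
    then have "neg a \<in> form_cone S"
      using total_cone_total [OF total_form_cone [OF S(2)]] by (simp add: neg_def)
    moreover have "neg (neg a) = a" by (simp add: neg_def)
    ultimately show ?thesis using q(2) [of "neg a"] False value_neg [of a] by (simp add: F_def)
  qed
  moreover have "form_value S b q = 0"
    using q(1) [of b] q(1) [of "neg b"] value_neg [of b] by (simp add: F_def)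
  moreover have "0 < q \<u>" using q(2) [of "e \<u>"] unit_strict value_e [OF S(3)] by (simp add: F_def)
  moreover have "\<bar>q x\<bar> \<le> int (unit_multiplier x) * q \<u>" if "x \<in> S" for x
    using q(1) [of "up x"] q(1) [of "lo x"] value_up [OF that] value_lo [OF that] that
    by (auto simp: F_def)
  ultimately show ?thesis by (auto simp: int_points_def)
qed

end

text \<open>By antisymmetry, a nonzero element or its inverse fails to be nonnegative, and some
  prime cone excludes that one. Read contrapositively, the result makes evaluation in G well defined
  on term functions.\<close>

lemma (in unital_lgroup) separating_point_exists:
  assumes S: "finite S" "S \<subseteq> carrier G" "\<u> \<in> S"
    and t: "term_vars t \<subseteq> S" "eval t = \<one>" and s: "term_vars s \<subseteq> S" "eval s \<noteq> \<one>"
  shows "\<exists>q\<in>int_points S t. int_eval q s \<noteq> 0"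
proof -
  have s_closed: "eval s \<in> carrier G" using S s by (intro eval_closed) auto
  obtain g where g: "g \<in> carrier G" "g = eval s \<or> g = inv (eval s)" "\<not> \<one> \<preceq> g"
  proof (cases "\<one> \<preceq> eval s")
    case True
    then have "\<not> \<one> \<preceq> inv (eval s)"
      using s(2) s_closed inv_le_iff [of \<one> "eval s"] le_antisym [of "eval s" \<one>] by auto
    then show ?thesis using that s_closed by auto
  qed (use s_closed in blast)
  obtain P where P: "lg_cone P" "\<forall>y\<in>carrier G. y \<in> P \<or> inv y \<in> P" "g \<notin> P"
    using prime_cone_exists [OF g(1,3)] by auto
  interpret prime_cone G P
    by unfold_locales (use P in auto)
  show ?thesis using separating_point [OF S t s(1)] P(3) g(2) by auto
qed

section \<open>Homomorphisms, and groups represented by integer-valued functions\<close>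

lemma ulg_homI:
  assumes "unital_lgroup G" "unital_lgroup H"
    and h: "h \<in> extensional (carrier G)" "\<And>x. x \<in> carrier G \<Longrightarrow> h x \<in> carrier H"
    and mult: "\<And>x y. x \<in> carrier G \<Longrightarrow> y \<in> carrier G \<Longrightarrow> h (x \<otimes>\<^bsub>G\<^esub> y) = h x \<otimes>\<^bsub>H\<^esub> h y"
    and join: "\<And>x y. x \<in> carrier G \<Longrightarrow> y \<in> carrier G \<Longrightarrow>
      h (x \<squnion>\<^bsub>ulg_order G\<^esub> y) = h x \<squnion>\<^bsub>ulg_order H\<^esub> h y"
    and unit: "h (ulg_unit G) = ulg_unit H"
  shows "h \<in> ulg_hom G H"
proof -
  interpret G: unital_lgroup G by fact
  interpret H: unital_lgroup H by fact
  have hom: "h \<in> hom G H" using h(2) mult by (auto simp: hom_def)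
  interpret group_hom G H h
    by unfold_locales (fact hom)
  have "h (x \<sqinter>\<^bsub>ulg_order G\<^esub> y) = h x \<sqinter>\<^bsub>ulg_order H\<^esub> h y"
    if "x \<in> carrier G" "y \<in> carrier G" for x y
    using that h(2) by (simp add: G.meet_conv_join H.meet_conv_join join)
  then show ?thesis using hom h(1) join unit by (simp add: ulg_hom_def)
qed

lemma ulg_homD:
  assumes "h \<in> ulg_hom G H"
  shows "h \<in> extensional (carrier G)" "x \<in> carrier G \<Longrightarrow> h x \<in> carrier H"
    "x \<in> carrier G \<Longrightarrow> y \<in> carrier G \<Longrightarrow> h (x \<otimes>\<^bsub>G\<^esub> y) = h x \<otimes>\<^bsub>H\<^esub> h y"
    "x \<in> carrier G \<Longrightarrow> y \<in> carrier G \<Longrightarrow> h (x \<squnion>\<^bsub>ulg_order G\<^esub> y) = h x \<squnion>\<^bsub>ulg_order H\<^esub> h y"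
    "h (ulg_unit G) = ulg_unit H" "h \<in> hom G H"
  using assms by (auto simp: ulg_hom_def hom_def)

lemma ulg_hom_compose:
  assumes "unital_lgroup G" "unital_lgroup K" "h \<in> ulg_hom G H" "k \<in> ulg_hom H K"
  shows "compose (carrier G) k h \<in> ulg_hom G K"
proof -
  interpret G: unital_lgroup G by fact
  show ?thesis
    by (rule ulg_homI) (use assms ulg_homD [OF assms(3)] ulg_homD [OF assms(4)] G.unit_closed in
      \<open>auto simp: compose_def\<close>)
qed

text \<open>A structure represented faithfully by integer functions inherits the axioms pointwise.
  The locale serves \<open>presented t\<close> on the points of \<open>t\<close> and
  \<open>int_chain d\<close> on a single point.\<close>

locale pointwise_lgroup =
  fixes K :: "('k, 'z) ulgroup_scheme" (structure) and V :: "'p set" and val :: "'k \<Rightarrow> 'p \<Rightarrow> int"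
  assumes val_inj: "x \<in> carrier K \<Longrightarrow> y \<in> carrier K \<Longrightarrow> (\<And>p. p \<in> V \<Longrightarrow> val x p = val y p) \<Longrightarrow> x = y"
    and mult_closed: "x \<in> carrier K \<Longrightarrow> y \<in> carrier K \<Longrightarrow> x \<otimes> y \<in> carrier K"
    and val_mult: "x \<in> carrier K \<Longrightarrow> y \<in> carrier K \<Longrightarrow> p \<in> V \<Longrightarrow> val (x \<otimes> y) p = val x p + val y p"
    and one_in: "\<one> \<in> carrier K" and val_one: "p \<in> V \<Longrightarrow> val \<one> p = 0"
    and neg_ex: "x \<in> carrier K \<Longrightarrow> \<exists>y\<in>carrier K. \<forall>p\<in>V. val y p = - val x p"
    and max_ex: "x \<in> carrier K \<Longrightarrow> y \<in> carrier K \<Longrightarrow> \<exists>z\<in>carrier K. \<forall>p\<in>V. val z p = max (val x p) (val y p)"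
    and le_iff: "x \<in> carrier K \<Longrightarrow> y \<in> carrier K \<Longrightarrow> ulg_le K x y \<longleftrightarrow> (\<forall>p\<in>V. val x p \<le> val y p)"
    and unit_in: "ulg_unit K \<in> carrier K" and val_unit: "p \<in> V \<Longrightarrow> 0 < val (ulg_unit K) p"
    and unit_dom: "x \<in> carrier K \<Longrightarrow> \<exists>n::nat. \<forall>p\<in>V. val x p \<le> int n * val (ulg_unit K) p"
    and points: "V \<noteq> {}"
begin

lemma comm_group: "comm_group K"
proof (rule comm_groupI)
  fix x assume x: "x \<in> carrier K"
  then obtain y where y: "y \<in> carrier K" "\<forall>p\<in>V. val y p = - val x p" using neg_ex by blast
  then have "y \<otimes> x = \<one>"
    by (intro val_inj) (use x in \<open>auto simp: mult_closed one_in val_mult val_one\<close>)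
  then show "\<exists>y\<in>carrier K. y \<otimes> x = \<one>" using y by blast
qed (auto simp: mult_closed one_in intro!: val_inj, auto simp: mult_closed one_in val_mult val_one)

lemma lub_max:
  assumes "x \<in> carrier K" "y \<in> carrier K" "z \<in> carrier K" "\<And>p. p \<in> V \<Longrightarrow> val z p = max (val x p) (val y p)"
  shows "least (ulg_order K) z (Upper (ulg_order K) {x, y})"
  using assms by (auto simp: least_def Upper_def le_iff)

lemma partial_order: "partial_order (ulg_order K)"
proof -
  have "x = y" if "\<forall>p\<in>V. val x p \<le> val y p" "\<forall>p\<in>V. val y p \<le> val x p" "x \<in> carrier K" "y \<in> carrier K"
    for x y using that by (intro val_inj) (auto intro: order.antisym)
  then show ?thesis
    by unfold_locales (auto simp: le_iff intro: order.trans)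
qed

lemma lattice: "lattice (ulg_order K)"
proof -
  interpret partial_order "ulg_order K" by (rule partial_order)
  show ?thesis
  proof unfold_locales
    fix x y assume xy: "x \<in> carrier (ulg_order K)" "y \<in> carrier (ulg_order K)"
    then show "\<exists>s. least (ulg_order K) s (Upper (ulg_order K) {x, y})"
      using max_ex [of x y] lub_max [of x y] by auto
    obtain x' y' where x': "x' \<in> carrier K" "\<forall>p\<in>V. val x' p = - val x p"
      and y': "y' \<in> carrier K" "\<forall>p\<in>V. val y' p = - val y p" 
      using neg_ex [of x] neg_ex [of y] xy by auto
    obtain z' where z': "z' \<in> carrier K" "\<forall>p\<in>V. val z' p = max (val x' p) (val y' p)"
      using max_ex x' y' by blast
    obtain z where z: "z \<in> carrier K" "\<forall>p\<in>V. val z p = - val z' p" using neg_ex z' by blast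
    have "val z p = min (val x p) (val y p)" if "p \<in> V" for p
      using that x' y' z' z by auto
    then have "greatest (ulg_order K) z (Lower (ulg_order K) {x, y})"
      using z xy by (auto simp: greatest_def Lower_def le_iff)
    then show "\<exists>s. greatest (ulg_order K) s (Lower (ulg_order K) {x, y})" by blast
  qed
qed

lemma val_pow: "p \<in> V \<Longrightarrow> val (ulg_unit K [^] (n::nat)) p = int n * val (ulg_unit K) p"
proof -
  interpret comm_group K by (rule comm_group)
  assume p: "p \<in> V"
  have "ulg_unit K [^] n \<in> carrier K" for n :: nat using unit_in by simp
  then show ?thesis
    by (induction n) (simp_all add: p val_one val_mult unit_in algebra_simps)
qed

lemma unital_lgroup: "unital_lgroup K"
proof -
  interpret comm_group K by (rule comm_group)
  show ?thesis
  proof (intro unital_lgroup.intro unital_lgroup_axioms.intro)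
    show "comm_group K" by (rule comm_group)
    show "lattice (ulg_order K)" by (rule lattice)
    show "ulg_unit K \<in> carrier K" by (rule unit_in)
    show "ulg_le K \<one> (ulg_unit K)"
      using val_unit by (auto simp: le_iff unit_in val_one less_imp_le)
    show "carrier K \<noteq> {\<one>}"
    proof
      assume "carrier K = {\<one>}"
      then have "ulg_unit K = \<one>" using unit_in by simp
      then show False using points val_unit val_one by force
    qed
    show "ulg_le K (z \<otimes> x) (z \<otimes> y)"
      if "x \<in> carrier K" "y \<in> carrier K" "z \<in> carrier K" "ulg_le K x y" for x y z
      using that by (simp add: le_iff val_mult)
    show "\<exists>n::int. ulg_le K x (ulg_unit K [^] n)" if x: "x \<in> carrier K" "ulg_le K \<one> x" for x
    proof -
      obtain n :: nat where "\<forall>p\<in>V. val x p \<le> int n * val (ulg_unit K) p" using unit_dom x by blast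
      then have "ulg_le K x (ulg_unit K [^] n)" using x by (simp add: le_iff unit_in val_pow)
      then have "ulg_le K x (ulg_unit K [^] int n)" by (simp add: int_pow_int)
      then show ?thesis by blast
    qed
  qed
qed

lemma join_eq:
  assumes "x \<in> carrier K" "y \<in> carrier K" "z \<in> carrier K" "\<And>p. p \<in> V \<Longrightarrow> val z p = max (val x p) (val y p)"
  shows "x \<squnion>\<^bsub>ulg_order K\<^esub> y = z"
proof -
  interpret unital_lgroup K by (rule unital_lgroup)
  show ?thesis using assms by (intro join_eqI) (auto simp: le_iff)
qed

end

section \<open>Groups of functions on integer points\<close>

text \<open>Terms must be stored in \<open>'a\<close>, because the objects of the index category and
  the elements of the test groups come from that type.\<close>

primrec encode_term :: "('a \<times> 'a \<Rightarrow> 'a) \<Rightarrow> (nat \<Rightarrow> 'a) \<Rightarrow> 'a lg_term \<Rightarrow> 'a" where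
  "encode_term pr c (Var x) = pr (c 0, x)"
| "encode_term pr c (Neg t) = pr (c 1, encode_term pr c t)"
| "encode_term pr c (Add s t) = pr (c 2, pr (encode_term pr c s, encode_term pr c t))"
| "encode_term pr c (Max s t) = pr (c 3, pr (encode_term pr c s, encode_term pr c t))"

lemma inj_encode_term:
  assumes pr: "inj pr" and c: "inj c"
  shows "inj (encode_term pr c)"
proof (rule injI)
  note [simp] = inj_eq [OF pr] inj_eq [OF c]
  show "encode_term pr c s = encode_term pr c t \<Longrightarrow> s = t" for s t
    by (induction s arbitrary: t; case_tac t) auto
qed

definition term_code :: "'a lg_term \<Rightarrow> 'a" where
  "term_code = (SOME e. inj e)"

definition term_decode :: "'a \<Rightarrow> 'a lg_term" where
  "term_decode = the_inv term_code"

text \<open>An infinite type is equinumerous with its square, which supplies the pairing, and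
  contains a copy of the naturals, which supplies the constructor tags.\<close>

lemma inj_term_code:
  assumes "infinite (UNIV :: 'a set)"
  shows "inj (term_code :: 'a lg_term \<Rightarrow> 'a)"
proof -
  obtain pr where "bij_betw pr ((UNIV :: 'a set) \<times> (UNIV :: 'a set)) (UNIV :: 'a set)"
    using card_of_Times_same_infinite [OF assms] card_of_ordIso by blast
  then have "inj pr" by (simp add: bij_betw_def)
  moreover obtain c :: "nat \<Rightarrow> 'a" where "inj c"
    using infinite_countable_subset [OF assms] by blast
  ultimately show ?thesis
    unfolding term_code_def by (intro someI [of inj]) (rule inj_encode_term)
qed

context unital_lgroup
begin

text \<open>A unit of finite order would be zero, squeezed between zero and a vanishing positive
  multiple of itself.\<close>

lemma infinite_carrier: "infinite (carrier G)"
proof -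
  have "inj (\<lambda>n::nat. \<u> [^] n)"
  proof (rule linorder_injI)
    fix m n :: nat assume "m < n"
    show "\<u> [^] m \<noteq> \<u> [^] n"
    proof
      assume eq: "\<u> [^] m = \<u> [^] n"
      define k where "k = n - m - 1"
      have "n = m + Suc k" using \<open>m < n\<close> by (simp add: k_def)
      then have "\<u> [^] m \<otimes> \<u> [^] Suc k = \<u> [^] m \<otimes> \<one>"
        using eq nat_pow_mult [OF unit_closed, of m "Suc k"] unit_closed by (simp del: nat_pow_Suc)
      then have "\<u> [^] Suc k = \<one>" using unit_closed Units_l_cancel [of "\<u> [^] m" "\<u> [^] Suc k" \<one>] by (simp add: Units_eq del: nat_pow_Suc)
      moreover have "\<u> \<preceq> \<u> [^] Suc k"
        using mult_right_le_iff [of \<one> "\<u> [^] k" \<u>] unit_ge_one_pow unit_closed by simp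
      ultimately show False
        using unit_neq_one le_antisym [of \<u> \<one>] unit_closed unit_nonneg by simp
    qed
  qed
  moreover have "range (\<lambda>n::nat. \<u> [^] n) \<subseteq> carrier G" using unit_closed by auto
  ultimately show ?thesis
    using finite_subset finite_imageD infinite_UNIV_nat by blast
qed

lemma term_decode_code [simp]: "term_decode (term_code s) = (s :: 'a lg_term)"
proof -
  have "infinite (UNIV :: 'a set)" using infinite_carrier finite_subset [OF subset_UNIV] by auto
  then show ?thesis unfolding term_decode_def by (simp add: the_inv_f_f inj_term_code)
qed

definition relators :: "'a lg_term set" where
  "relators = {t. term_vars t \<subseteq> carrier G \<and> eval t = \<one>}"

text \<open>The unit is always included, so that it is present in the group of \<open>t\<close> even
  if \<open>t\<close> does not mention it.\<close>

definition support :: "'a lg_term \<Rightarrow> 'a set" where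
  "support t = insert \<u> (term_vars t)"

definition points :: "'a lg_term \<Rightarrow> ('a \<Rightarrow> int) set" where
  "points t = int_points (support t) t"

text \<open>Classes of terms would be sets and leave the type \<open>'a\<close>, so a chosen
  representative stands for its class. The choice depends on \<open>s\<close> only through its
  values on the points, hence equal term functions receive equal codes.\<close>

definition code :: "'a lg_term \<Rightarrow> 'a lg_term \<Rightarrow> 'a" where
  "code t s = term_code (SOME s'. term_vars s' \<subseteq> support t \<and> (\<forall>q\<in>points t. int_eval q s' = int_eval q s))"

lemma finite_support [simp]: "finite (support t)"
  by (simp add: support_def)

lemma unit_in_support [simp]: "\<u> \<in> support t"
  by (simp add: support_def)

lemma support_closed: "t \<in> relators \<Longrightarrow> support t \<subseteq> carrier G"
  using unit_closed by (auto simp: support_def relators_def)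

lemma eval_in_carrier: "t \<in> relators \<Longrightarrow> term_vars s \<subseteq> support t \<Longrightarrow> eval s \<in> carrier G"
  using support_closed eval_closed by blast

lemma decode_code:
  assumes "term_vars s \<subseteq> support t"
  shows "term_vars (term_decode (code t s)) \<subseteq> support t"
    and "q \<in> points t \<Longrightarrow> int_eval q (term_decode (code t s)) = int_eval q s"
proof -
  have "\<exists>s'. term_vars s' \<subseteq> support t \<and> (\<forall>q\<in>points t. int_eval q s' = int_eval q s)"
    using assms by blast
  from someI_ex [OF this] show "term_vars (term_decode (code t s)) \<subseteq> support t"
    "q \<in> points t \<Longrightarrow> int_eval q (term_decode (code t s)) = int_eval q s"
    by (simp_all add: code_def)
qed

lemma code_eq_iff:
  assumes "term_vars s \<subseteq> support t" "term_vars s' \<subseteq> support t"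
  shows "code t s = code t s' \<longleftrightarrow> (\<forall>q\<in>points t. int_eval q s = int_eval q s')"
proof
  show "code t s = code t s'" if "\<forall>q\<in>points t. int_eval q s = int_eval q s'"
    using that by (simp add: code_def)
qed (use decode_code assms in metis)

text \<open>The difference of the two terms vanishes at all points of \<open>t\<close>, so by
  separation it vanishes in G. This is what makes \<open>canonical t\<close> well defined.\<close>

lemma eval_eq_if_code_eq:
  assumes t: "t \<in> relators" and s: "term_vars s \<subseteq> support t" "term_vars s' \<subseteq> support t"
    and eq: "code t s = code t s'"
  shows "eval s = eval s'"
proof (rule ccontr)
  assume "eval s \<noteq> eval s'"
  have closed: "eval s \<in> carrier G" "eval s' \<in> carrier G" using eval_in_carrier t s by auto
  have "eval (Add s (Neg s')) \<noteq> \<one>"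
  proof
    assume "eval (Add s (Neg s')) = \<one>"
    then have "inv (inv (eval s')) = eval s" using closed by (intro inv_equality) auto
    then show False using closed \<open>eval s \<noteq> eval s'\<close> by simp
  qed
  moreover have "term_vars t \<subseteq> support t" "eval t = \<one>"
    using t by (auto simp: support_def relators_def)
  ultimately obtain q where "q \<in> points t" "int_eval q (Add s (Neg s')) \<noteq> 0"
    using separating_point_exists [of "support t" t "Add s (Neg s')"] support_closed [OF t] s
    by (auto simp: points_def)
  then show False using eq s by (auto simp: code_eq_iff)
qed

text \<open>The group D_t of the overview. Since terms have no constant, the code of u - u, for the
  unit u, represents its zero.\<close>

definition presented :: "'a lg_term \<Rightarrow> 'a ulgroup" where
  "presented t = \<lparr>carrier = code t ` {s. term_vars s \<subseteq> support t},
     mult = (\<lambda>x y. code t (Add (term_decode x) (term_decode y))),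
     one = code t (Add (Var \<u>) (Neg (Var \<u>))),
     ulg_le = (\<lambda>x y. \<forall>q\<in>points t. int_eval q (term_decode x) \<le> int_eval q (term_decode y)),
     ulg_unit = code t (Var \<u>)\<rparr>"

lemma code_in_presented: "term_vars s \<subseteq> support t \<Longrightarrow> code t s \<in> carrier (presented t)"
  by (auto simp: presented_def)

lemma presentedE:
  assumes "x \<in> carrier (presented t)"
  obtains s where "term_vars s \<subseteq> support t" "x = code t s"
  using assms by (auto simp: presented_def)

lemma decode_presented:
  assumes "x \<in> carrier (presented t)"
  shows "term_vars (term_decode x) \<subseteq> support t" "code t (term_decode x) = x"
proof -
  obtain s where s: "term_vars s \<subseteq> support t" "x = code t s" using assms by (rule presentedE)
  then show "term_vars (term_decode x) \<subseteq> support t" using decode_code(1) by simp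
  then show "code t (term_decode x) = x" using s by (simp add: code_eq_iff decode_code(2))
qed

text \<open>The bounds on the variables in \<open>int_points\<close> propagate to all terms; hence
  the unit of \<open>presented t\<close> dominates.\<close>

lemma int_eval_bounded:
  assumes "term_vars s \<subseteq> support t"
  shows "\<exists>n::nat. \<forall>q\<in>points t. \<bar>int_eval q s\<bar> \<le> int n * q \<u>"
  using assms
proof (induction s)
  case (Var x)
  then show ?case
    by (intro exI [of _ "unit_multiplier x"]) (auto simp: points_def int_points_def)
next
  case (Add s1 s2)
  then obtain m n :: nat where mn: "\<And>q. q \<in> points t \<Longrightarrow> \<bar>int_eval q s1\<bar> \<le> int m * q \<u>"
    "\<And>q. q \<in> points t \<Longrightarrow> \<bar>int_eval q s2\<bar> \<le> int n * q \<u>" by auto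
  have "\<bar>int_eval q (Add s1 s2)\<bar> \<le> int (m + n) * q \<u>" if "q \<in> points t" for q
    using mn [OF that] by (simp add: algebra_simps)
  then show ?case by blast
next
  case (Max s1 s2)
  then obtain m n :: nat where mn: "\<And>q. q \<in> points t \<Longrightarrow> \<bar>int_eval q s1\<bar> \<le> int m * q \<u>"
    "\<And>q. q \<in> points t \<Longrightarrow> \<bar>int_eval q s2\<bar> \<le> int n * q \<u>" by auto
  have "\<bar>int_eval q (Max s1 s2)\<bar> \<le> int (m + n) * q \<u>" if "q \<in> points t" for q
    using mn [OF that] by (simp add: algebra_simps)
  then show ?case by blast
qed auto

text \<open>Separation is applied to the unit, which is a nonzero element of G.\<close>

lemma points_nonempty:
  assumes "t \<in> relators"
  shows "points t \<noteq> {}"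
proof -
  have "term_vars t \<subseteq> support t" "eval t = \<one>"
    using assms by (auto simp: support_def relators_def)
  then show ?thesis
    using separating_point_exists [of "support t" t "Var \<u>"] support_closed [OF assms] unit_neq_one
    by (auto simp: points_def)
qed

lemma pointwise_presented:
  assumes "t \<in> relators"
  shows "pointwise_lgroup (presented t) (points t) (\<lambda>x q. int_eval q (term_decode x))"
proof
  let ?C = "carrier (presented t)"
  have val: "int_eval q (term_decode (code t s)) = int_eval q s"
    if "term_vars s \<subseteq> support t" "q \<in> points t" for s q
    using decode_code that by blast
  have code: "code t s \<in> ?C" if "term_vars s \<subseteq> support t" for s
    using that by (rule code_in_presented)
  show "x = y" if "x \<in> ?C" "y \<in> ?C"
    "\<And>q. q \<in> points t \<Longrightarrow> int_eval q (term_decode x) = int_eval q (term_decode y)" for x y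
    using that decode_presented code_eq_iff by metis
  note dec = decode_presented(1)
  show "x \<otimes>\<^bsub>presented t\<^esub> y \<in> ?C" if "x \<in> ?C" "y \<in> ?C" for x y
    using code [of "Add (term_decode x) (term_decode y)"] that dec [of x] dec [of y]
    by (simp add: presented_def)
  show "int_eval q (term_decode (x \<otimes>\<^bsub>presented t\<^esub> y)) = int_eval q (term_decode x) + int_eval q (term_decode y)"
    if "x \<in> ?C" "y \<in> ?C" "q \<in> points t" for x y q
    using that val [of "Add (term_decode x) (term_decode y)"] dec [of x] dec [of y]
    by (simp add: presented_def)
  show "\<one>\<^bsub>presented t\<^esub> \<in> ?C" "ulg_unit (presented t) \<in> ?C"
    by (simp_all add: presented_def)
  show "int_eval q (term_decode \<one>\<^bsub>presented t\<^esub>) = 0" if "q \<in> points t" for q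
    using that by (simp add: presented_def val)
  show "0 < int_eval q (term_decode (ulg_unit (presented t)))" if "q \<in> points t" for q
    using that by (simp add: presented_def val) (simp add: points_def int_points_def)
  show "\<exists>y\<in>?C. \<forall>q\<in>points t. int_eval q (term_decode y) = - int_eval q (term_decode x)"
    if "x \<in> ?C" for x
    using code [of "Neg (term_decode x)"] val [of "Neg (term_decode x)"] dec [OF that] by auto
  show "\<exists>z\<in>?C. \<forall>q\<in>points t. int_eval q (term_decode z) =
      max (int_eval q (term_decode x)) (int_eval q (term_decode y))" if "x \<in> ?C" "y \<in> ?C" for x y
    using code [of "Max (term_decode x) (term_decode y)"] val [of "Max (term_decode x) (term_decode y)"]
      dec [OF that(1)] dec [OF that(2)] by auto
  show "ulg_le (presented t) x y \<longleftrightarrow> (\<forall>q\<in>points t. int_eval q (term_decode x) \<le> int_eval q (term_decode y))"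
    for x y by (simp add: presented_def)
  show "\<exists>n::nat. \<forall>q\<in>points t. int_eval q (term_decode x) \<le> int n * int_eval q (term_decode (ulg_unit (presented t)))"
    if x: "x \<in> ?C" for x
  proof -
    obtain n :: nat where n: "\<And>q. q \<in> points t \<Longrightarrow> \<bar>int_eval q (term_decode x)\<bar> \<le> int n * q \<u>"
      using int_eval_bounded [OF dec [OF x]] by blast
    have "int_eval q (term_decode x) \<le> int n * int_eval q (term_decode (ulg_unit (presented t)))"
      if "q \<in> points t" for q
      using n [OF that] that by (simp add: presented_def val)
    then show ?thesis by blast
  qed
  show "points t \<noteq> {}" using assms by (rule points_nonempty)
qed

lemma unital_lgroup_presented: "t \<in> relators \<Longrightarrow> unital_lgroup (presented t)"
  using pointwise_presented pointwise_lgroup.unital_lgroup by blast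

lemma presented_ops:
  assumes "t \<in> relators" and s: "term_vars s \<subseteq> support t" "term_vars s' \<subseteq> support t"
  shows "code t s \<otimes>\<^bsub>presented t\<^esub> code t s' = code t (Add s s')"
    and "code t s \<squnion>\<^bsub>ulg_order (presented t)\<^esub> code t s' = code t (Max s s')"
    and "ulg_unit (presented t) = code t (Var \<u>)"
proof -
  interpret pointwise_lgroup "presented t" "points t" "\<lambda>x q. int_eval q (term_decode x)"
    using assms(1) by (rule pointwise_presented)
  show "code t s \<otimes>\<^bsub>presented t\<^esub> code t s' = code t (Add s s')"
    using s by (simp add: presented_def code_eq_iff decode_code)
  show "code t s \<squnion>\<^bsub>ulg_order (presented t)\<^esub> code t s' = code t (Max s s')"
    using s by (intro join_eq) (auto simp: code_in_presented decode_code)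
  show "ulg_unit (presented t) = code t (Var \<u>)" by (simp add: presented_def)
qed

text \<open>The common form of all maps out of \<open>presented t\<close>: the map to G, the
  transition maps and the evaluations at points are instances. Compatibility with
  \<open>code\<close> is left to the lemmas that use it.\<close>

definition induced :: "'a lg_term \<Rightarrow> ('a lg_term \<Rightarrow> 'k) \<Rightarrow> 'a \<Rightarrow> 'k" where
  "induced t F = (\<lambda>x\<in>carrier (presented t). F (term_decode x))"

lemma induced_code:
  assumes "term_vars s \<subseteq> support t"
    and "\<And>s s'. term_vars s \<subseteq> support t \<Longrightarrow> term_vars s' \<subseteq> support t \<Longrightarrow> code t s = code t s' \<Longrightarrow> F s = F s'"
  shows "induced t F (code t s) = F s"
proof -
  have x: "code t s \<in> carrier (presented t)" using assms(1) by (rule code_in_presented)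
  have "F (term_decode (code t s)) = F s"
    using decode_presented [OF x] assms(1) by (intro assms(2)) auto
  then show ?thesis using x by (simp add: induced_def)
qed

lemma induced_hom:
  assumes t: "t \<in> relators" and K: "unital_lgroup K"
    and F: "\<And>s. term_vars s \<subseteq> support t \<Longrightarrow> F s \<in> carrier K"
    and compat: "\<And>s s'. term_vars s \<subseteq> support t \<Longrightarrow> term_vars s' \<subseteq> support t \<Longrightarrow>
      code t s = code t s' \<Longrightarrow> F s = F s'"
    and Add: "\<And>s s'. term_vars s \<subseteq> support t \<Longrightarrow> term_vars s' \<subseteq> support t \<Longrightarrow> F (Add s s') = F s \<otimes>\<^bsub>K\<^esub> F s'"
    and Max: "\<And>s s'. term_vars s \<subseteq> support t \<Longrightarrow> term_vars s' \<subseteq> support t \<Longrightarrow>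
      F (Max s s') = F s \<squnion>\<^bsub>ulg_order K\<^esub> F s'"
    and unit: "F (Var \<u>) = ulg_unit K"
  shows "induced t F \<in> ulg_hom (presented t) K"
proof (rule ulg_homI [OF unital_lgroup_presented [OF t] K])
  note ind = induced_code [where F = F, OF _ compat]
  show "induced t F \<in> extensional (carrier (presented t))" by (simp add: induced_def)
  show "induced t F x \<in> carrier K" if "x \<in> carrier (presented t)" for x
    using that by (auto elim!: presentedE simp: ind F)
  fix x y assume "x \<in> carrier (presented t)" "y \<in> carrier (presented t)"
  then obtain s s' where s: "term_vars s \<subseteq> support t" "x = code t s" "term_vars s' \<subseteq> support t" "y = code t s'"
    by (metis presentedE)
  show "induced t F (x \<otimes>\<^bsub>presented t\<^esub> y) = induced t F x \<otimes>\<^bsub>K\<^esub> induced t F y"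
    using s by (simp add: presented_ops [OF t] ind Add)
  show "induced t F (x \<squnion>\<^bsub>ulg_order (presented t)\<^esub> y) =
      induced t F x \<squnion>\<^bsub>ulg_order K\<^esub> induced t F y"
    using s by (simp add: presented_ops [OF t] ind Max)
next
  show "induced t F (ulg_unit (presented t)) = ulg_unit K"
    using induced_code [where F = F, OF _ compat, of "Var \<u>"] presented_ops(3) [OF t, of "Var \<u>" "Var \<u>"] unit by simp
qed

end

section \<open>Homomorphisms into chains of integers\<close>

lemma int_eval_cong: "(\<And>x. x \<in> term_vars s \<Longrightarrow> q x = q' x) \<Longrightarrow> int_eval q s = int_eval q' s"
  by (induction s) simp_all

definition int_chain :: "int \<Rightarrow> int ulgroup" where
  "int_chain d = \<lparr>carrier = UNIV, mult = (+), one = 0, ulg_le = (\<le>), ulg_unit = d\<rparr>"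

lemma pointwise_int_chain:
  assumes "d > 0"
  shows "pointwise_lgroup (int_chain d) {()} (\<lambda>x _. x)"
proof
  show "\<exists>n::nat. \<forall>p\<in>{()}. x \<le> int n * ulg_unit (int_chain d)" for x :: int
  proof -
    have "x \<le> int (nat \<bar>x\<bar>) * d"
      using assms mult_left_mono [of 1 d "\<bar>x\<bar>"] by simp
    then show ?thesis by (intro exI [of _ "nat \<bar>x\<bar>"]) (simp add: int_chain_def)
  qed
  show "\<exists>y\<in>carrier (int_chain d). \<forall>p\<in>{()}. y = - x" for x
    by (simp add: int_chain_def)
  show "\<exists>z\<in>carrier (int_chain d). \<forall>p\<in>{()}. z = max x y" for x y
    by (simp add: int_chain_def)
qed (use assms in \<open>simp_all add: int_chain_def\<close>)

lemma unital_lgroup_int_chain: "d > 0 \<Longrightarrow> unital_lgroup (int_chain d)"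
  using pointwise_int_chain pointwise_lgroup.unital_lgroup by blast

lemma int_chain_simps [simp]:
  "carrier (int_chain d) = UNIV" "x \<otimes>\<^bsub>int_chain d\<^esub> y = x + y" "\<one>\<^bsub>int_chain d\<^esub> = 0"
  "ulg_unit (int_chain d) = d"
  by (simp_all add: int_chain_def)

lemma int_chain_join: "d > 0 \<Longrightarrow> x \<squnion>\<^bsub>ulg_order (int_chain d)\<^esub> y = max x y"
  by (rule pointwise_lgroup.join_eq [OF pointwise_int_chain]) auto

context unital_lgroup
begin

text \<open>Variables are elements of G, so \<open>h\<close> itself is the assignment. Hence
  \<open>h\<close> is determined by its values on a generating set.\<close>

lemma hom_int_chain_eval:
  assumes d: "d > 0" and h: "h \<in> ulg_hom G (int_chain d)" and s: "term_vars s \<subseteq> carrier G"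
  shows "h (eval s) = int_eval h s"
  using s
proof (induction s)
  case (Neg s)
  have "h (inv (eval s) \<otimes> eval s) = h (inv (eval s)) + h (eval s)"
    using Neg.prems ulg_homD(3) [OF h, of "inv (eval s)" "eval s"] by simp
  moreover have "h \<one> = 0"
    using ulg_homD(3) [OF h, of \<one> \<one>] by simp
  ultimately show ?case using Neg by simp
next
  case (Add s1 s2)
  then show ?case using ulg_homD(3) [OF h, of "eval s1" "eval s2"] by simp
next
  case (Max s1 s2)
  then show ?case using ulg_homD(4) [OF h, of "eval s1" "eval s2"] d by (simp add: int_chain_join)
qed simp

lemma hom_int_chain_bound:
  assumes d: "d > 0" and h: "h \<in> ulg_hom G (int_chain d)" and x: "x \<in> carrier G"
  shows "\<bar>h x\<bar> \<le> int (unit_multiplier x) * d"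
proof -
  note unit_closed [simp]
  have one: "h \<one> = 0" using ulg_homD(3) [OF h, of \<one> \<one>] by simp
  have pow: "h (\<u> [^] n) = int n * d" for n :: nat
    by (induction n) (use one ulg_homD(3,5) [OF h] in \<open>simp_all add: algebra_simps\<close>)
  have mono: "h y \<le> h z" if "y \<preceq> z" "y \<in> carrier G" "z \<in> carrier G" for y z
    using that d ulg_homD(4) [OF h, of y z] by (simp add: le_iff_join int_chain_join)
  have "h (inv x) = - h x"
    using ulg_homD(3) [OF h, of "inv x" x] x one by simp
  then show ?thesis
    using mono [OF unit_multiplier(1) [OF x]] mono [OF unit_multiplier(2) [OF x]] x
    by (simp add: pow)
qed

section \<open>Maps out of the groups of functions, and Malcev's argument\<close>

definition canonical :: "'a lg_term \<Rightarrow> 'a \<Rightarrow> 'a" where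
  "canonical t = induced t eval"

lemma canonical_code:
  assumes "t \<in> relators" "term_vars s \<subseteq> support t"
  shows "canonical t (code t s) = eval s"
  unfolding canonical_def
  by (rule induced_code [OF assms(2)]) (rule eval_eq_if_code_eq [OF assms(1)])

lemma canonical_hom: "t \<in> relators \<Longrightarrow> canonical t \<in> ulg_hom (presented t) G"
  unfolding canonical_def
  by (rule induced_hom [OF _ unital_lgroup_axioms _ eval_eq_if_code_eq]) (auto simp: eval_in_carrier)

lemma point_hom:
  assumes t: "t \<in> relators" and q: "q \<in> points t"
  shows "induced t (int_eval q) \<in> ulg_hom (presented t) (int_chain (q \<u>))"
proof -
  have "0 < q \<u>" using q by (simp add: points_def int_points_def)
  then show ?thesis
    by (intro induced_hom [OF t unital_lgroup_int_chain])
      (use q in \<open>auto simp: int_chain_join code_eq_iff\<close>)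
qed

text \<open>Restriction to the generators is injective and lands in a finite product of intervals,
  because the bound on \<open>h x\<close> depends only on \<open>x\<close> and
  \<open>d\<close>.\<close>

lemma finite_hom_int_chain:
  assumes d: "d > 0" and S: "finite S" "S \<subseteq> carrier G"
    and gen: "\<And>x. x \<in> carrier G \<Longrightarrow> \<exists>s. term_vars s \<subseteq> S \<and> x = eval s"
  shows "finite (ulg_hom G (int_chain d))"
proof (rule finite_imageD)
  let ?I = "\<lambda>x. {- (int (unit_multiplier x) * d)..int (unit_multiplier x) * d}"
  have "(\<lambda>h. restrict h S) ` ulg_hom G (int_chain d) \<subseteq> PiE S ?I"
  proof (intro image_subsetI)
    fix h assume h: "h \<in> ulg_hom G (int_chain d)"
    have "h x \<in> ?I x" if "x \<in> S" for x
      using hom_int_chain_bound [OF d h, of x] that S by auto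
    then show "restrict h S \<in> PiE S ?I" by auto
  qed
  then show "finite ((\<lambda>h. restrict h S) ` ulg_hom G (int_chain d))"
    by (rule finite_subset) (simp add: finite_PiE S)
  show "inj_on (\<lambda>h. restrict h S) (ulg_hom G (int_chain d))"
  proof (rule inj_onI)
    fix h h' assume h: "h \<in> ulg_hom G (int_chain d)" "h' \<in> ulg_hom G (int_chain d)"
      and eq: "restrict h S = restrict h' S"
    show "h = h'"
    proof (rule extensionalityI [OF ulg_homD(1) [OF h(1)] ulg_homD(1) [OF h(2)]])
      fix x assume "x \<in> carrier G"
      then obtain s where s: "term_vars s \<subseteq> S" "x = eval s" using gen by auto
      have "h y = h' y" if "y \<in> term_vars s" for y
        using fun_cong [OF eq, of y] that s(1) by (simp add: subset_iff)
      then have "int_eval h s = int_eval h' s" by (rule int_eval_cong)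
      then show "h x = h' x"
        using hom_int_chain_eval [OF d h(1), of s] hom_int_chain_eval [OF d h(2), of s] s S by auto
    qed
  qed
qed

text \<open>Malcev's argument: composition with a surjective endomorphism permutes the finite set of
  homomorphisms into \<open>int_chain d\<close>, so all these homomorphisms vanish on its kernel.\<close>

lemma hopfian_if_section:
  assumes t: "t \<in> relators" and \<theta>: "\<theta> \<in> ulg_hom G (presented t)"
    and sec: "\<And>x. x \<in> carrier G \<Longrightarrow> canonical t (\<theta> x) = x"
  shows "hopfian G"
proof -
  have "inj_on \<sigma> (carrier G)" if \<sigma>: "\<sigma> \<in> ulg_epi G G" for \<sigma>
  proof (rule inj_onI, rule ccontr)
    fix x y assume xy: "x \<in> carrier G" "y \<in> carrier G" "\<sigma> x = \<sigma> y" "x \<noteq> y"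
    have \<sigma>_hom: "\<sigma> \<in> ulg_hom G G" and \<sigma>_surj: "\<sigma> ` carrier G = carrier G"
      using \<sigma> by (auto simp: ulg_epi_def)
    have \<theta>_in: "\<theta> z \<in> carrier (presented t)" if "z \<in> carrier G" for z
      using ulg_homD(2) [OF \<theta> that] .
    have "\<theta> x \<noteq> \<theta> y" using sec [OF xy(1)] sec [OF xy(2)] xy(4) by auto
    then obtain q where q: "q \<in> points t" "int_eval q (term_decode (\<theta> x)) \<noteq> int_eval q (term_decode (\<theta> y))"
      using pointwise_lgroup.val_inj [OF pointwise_presented [OF t] \<theta>_in \<theta>_in] xy by blast
    define d where "d = q \<u>"
    have d: "d > 0" using q by (simp add: d_def points_def int_points_def)
    define H where "H = ulg_hom G (int_chain d)"
    define h where "h = compose (carrier G) (induced t (int_eval q)) \<theta>"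
    have h: "h \<in> H"
      unfolding h_def H_def d_def
      using unital_lgroup_axioms unital_lgroup_int_chain [OF d [unfolded d_def]] \<theta> point_hom [OF t q(1)]
      by (rule ulg_hom_compose)
    have h_xy: "h x \<noteq> h y"
      using q(2) xy \<theta>_in by (simp add: h_def compose_def induced_def)
    \<comment> \<open>The section exhibits the finite set \<open>support t\<close> as generators of
      G.\<close>
    have "\<exists>s. term_vars s \<subseteq> support t \<and> z = eval s" if z: "z \<in> carrier G" for z
    proof -
      obtain s where "term_vars s \<subseteq> support t" "\<theta> z = code t s"
        using \<theta>_in [OF z] by (rule presentedE)
      then show ?thesis using sec [OF z] canonical_code [OF t] by auto
    qed
    then have "finite H"
      unfolding H_def using finite_hom_int_chain [OF d finite_support support_closed [OF t]] by auto
    moreover have "(\<lambda>h. compose (carrier G) h \<sigma>) ` H \<subseteq> H"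
      unfolding H_def using ulg_hom_compose [OF unital_lgroup_axioms unital_lgroup_int_chain [OF d] \<sigma>_hom]
      by auto
    moreover have "inj_on (\<lambda>h. compose (carrier G) h \<sigma>) H"
    proof (rule inj_onI)
      fix h h' assume hh: "h \<in> H" "h' \<in> H" and eq: "compose (carrier G) h \<sigma> = compose (carrier G) h' \<sigma>"
      show "h = h'"
      proof (rule extensionalityI [of _ "carrier G"])
        fix z assume "z \<in> carrier G"
        then obtain w where "w \<in> carrier G" "z = \<sigma> w" using \<sigma>_surj by auto
        then show "h z = h' z" using fun_cong [OF eq, of w] by (simp add: compose_def)
      qed (use hh ulg_homD(1) in \<open>auto simp: H_def\<close>)
    qed
    ultimately have "(\<lambda>h. compose (carrier G) h \<sigma>) ` H = H" by (rule endo_inj_surj)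
    then obtain h' where "h = compose (carrier G) h' \<sigma>" using h by auto
    then show False using h_xy xy by (simp add: compose_def)
  qed
  then show ?thesis
    by (auto simp: hopfian_def ulg_iso_def ulg_epi_def bij_betw_def)
qed

section \<open>The directed preorder of relators\<close>

definition join_relator :: "'a lg_term \<Rightarrow> 'a lg_term \<Rightarrow> 'a lg_term" where
  "join_relator t t' = Add (Max t (Neg t)) (Max t' (Neg t'))"

text \<open>Under these conditions a term function on the points of \<open>t\<close> restricts to
  one on the points of \<open>t'\<close>, so sending codes for \<open>t\<close> to codes for
  \<open>t'\<close> is well defined.\<close>

definition below :: "'a lg_term \<Rightarrow> 'a lg_term \<Rightarrow> bool" where
  "below t t' \<longleftrightarrow> support t \<subseteq> support t' \<and> points t' \<subseteq> points t"

lemma below_refl [simp]: "below t t" and below_trans: "below t t' \<Longrightarrow> below t' t'' \<Longrightarrow> below t t''"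
  by (auto simp: below_def)

text \<open>\<open>Max t (Neg t)\<close> is the absolute value of \<open>t\<close>, so the sum
  vanishes only where both terms do.\<close>

lemma join_relator:
  assumes "t \<in> relators" "t' \<in> relators"
  shows "join_relator t t' \<in> relators" "below t (join_relator t t')" "below t' (join_relator t t')"
proof -
  have "\<one> \<curlyvee> \<one> = \<one>" by (intro join_eqI) auto
  then show "join_relator t t' \<in> relators"
    using assms by (simp add: relators_def join_relator_def)
  have "int_eval q t = 0 \<and> int_eval q t' = 0" if "int_eval q (join_relator t t') = 0" for q
    using that by (simp add: join_relator_def max_def split: if_splits)
  then show "below t (join_relator t t')" "below t' (join_relator t t')"
    by (auto simp: below_def points_def int_points_def support_def join_relator_def)
qed

text \<open>A vacuous equation whose purpose is to bring \<open>x\<close> into the support.\<close>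

definition var_relator :: "'a \<Rightarrow> 'a lg_term" where
  "var_relator x = Add (Var x) (Neg (Var x))"

lemma var_relator: "x \<in> carrier G \<Longrightarrow> var_relator x \<in> relators" "x \<in> support (var_relator x)"
  by (auto simp: var_relator_def relators_def support_def)

lemma relator_with_support:
  assumes "finite X" "X \<subseteq> carrier G"
  shows "\<exists>t\<in>relators. X \<subseteq> support t"
  using assms
proof (induction X rule: finite_induct)
  case empty
  show ?case using var_relator(1) [OF unit_closed] by blast
next
  case (insert x X)
  then obtain t where t: "t \<in> relators" "X \<subseteq> support t" by auto
  have x: "var_relator x \<in> relators" using insert.prems by (simp add: var_relator)
  have "insert x X \<subseteq> support (join_relator t (var_relator x))"
    using join_relator(2,3) [OF t(1) x] t(2) var_relator(2) [of x] by (auto simp: below_def)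
  then show ?case using join_relator(1) [OF t(1) x] by blast
qed

text \<open>This turns finite generation, stated with subgroups, into surjectivity of a map from
  term functions.\<close>

lemma generated_by_terms:
  assumes S: "S \<subseteq> carrier G" "\<u> \<in> S"
  shows "unital_lsubgroup (eval ` {s. term_vars s \<subseteq> S}) G" (is "unital_lsubgroup ?T G")
  unfolding unital_lsubgroup_def
proof (intro conjI ballI)
  have closed: "eval s \<in> carrier G" if "term_vars s \<subseteq> S" for s using that S by auto
  have I: "eval s \<in> ?T" if "term_vars s \<subseteq> S" for s using that by blast
  show "\<u> \<in> ?T" using I [of "Var \<u>"] S by simp
  show "subgroup ?T G"
  proof (rule subgroupI)
    show "?T \<subseteq> carrier G" using closed by blast
    show "?T \<noteq> {}" using I [of "Var \<u>"] S by auto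
  next
    fix x assume "x \<in> ?T"
    then obtain s where "term_vars s \<subseteq> S" "x = eval s" by blast
    then show "inv x \<in> ?T" using I [of "Neg s"] by simp
  next
    fix x y assume "x \<in> ?T" "y \<in> ?T"
    then obtain s s' where "term_vars s \<subseteq> S" "x = eval s" "term_vars s' \<subseteq> S" "y = eval s'" by blast
    then show "x \<otimes> y \<in> ?T" using I [of "Add s s'"] by simp
  qed
  fix x y assume "x \<in> ?T" "y \<in> ?T"
  then obtain s s' where s: "term_vars s \<subseteq> S" "x = eval s" "term_vars s' \<subseteq> S" "y = eval s'" by blast
  then show "x \<curlyvee> y \<in> ?T" using I [of "Max s s'"] by simp
  show "x \<curlywedge> y \<in> ?T"
    using I [of "Neg (Max (Neg s) (Neg s'))"] s closed [of s] closed [of s'] by (simp add: meet_conv_join)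
qed

end

section \<open>Filtered colimits\<close>

text \<open>Cocones and projectivity are defined for records without extension fields; with this
  type G can be the vertex of a cocone over the groups \<open>presented t\<close>.\<close>

locale plain_unital_lgroup = unital_lgroup G for G :: "'a ulgroup" (structure)
begin

definition transition :: "'a lg_term \<Rightarrow> 'a lg_term \<Rightarrow> 'a \<Rightarrow> 'a" where
  "transition t t' = induced t (code t')"

lemma below_code_eq:
  assumes "below t t'" "term_vars s \<subseteq> support t" "term_vars s' \<subseteq> support t" "code t s = code t s'"
  shows "code t' s = code t' s'"
proof -
  have sub: "support t \<subseteq> support t'" "points t' \<subseteq> points t" using assms(1) by (simp_all add: below_def)
  have "\<forall>q\<in>points t. int_eval q s = int_eval q s'" using assms(2-4) by (simp add: code_eq_iff)
  then have "\<forall>q\<in>points t'. int_eval q s = int_eval q s'" using sub(2) by auto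
  then show ?thesis
    using assms(2,3) sub(1) by (subst code_eq_iff) auto
qed

lemma transition_code:
  assumes "below t t'" "term_vars s \<subseteq> support t"
  shows "transition t t' (code t s) = code t' s"
  unfolding transition_def
  by (rule induced_code [OF assms(2)]) (rule below_code_eq [OF assms(1)])

lemma transition_hom:
  assumes "t \<in> relators" "t' \<in> relators" "below t t'"
  shows "transition t t' \<in> ulg_hom (presented t) (presented t')"
proof -
  have "support t \<subseteq> support t'" using assms(3) by (simp add: below_def)
  then show ?thesis
    unfolding transition_def
    by (intro induced_hom [OF assms(1) unital_lgroup_presented [OF assms(2)] _ below_code_eq [OF assms(3)]])
      (auto simp: code_in_presented presented_ops(1,2) [OF assms(2)] subset_trans
        presented_ops(3) [OF assms(2), of "Var \<u>" "Var \<u>"])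
qed

lemma presented_ext:
  assumes "f \<in> extensional (carrier (presented t))" "g \<in> extensional (carrier (presented t))"
    and "\<And>s. term_vars s \<subseteq> support t \<Longrightarrow> f (code t s) = g (code t s)"
  shows "f = g"
  by (rule extensionalityI [OF assms(1,2)]) (use assms(3) in \<open>auto elim!: presentedE\<close>)

text \<open>\<open>G\<close> is the filtered colimit of the groups \<open>presented t\<close>, indexed by the terms \<open>t\<close> that
  vanish in \<open>G\<close>. The index category is the preorder \<open>below\<close>, coded in the type \<open>'a\<close>.\<close>

definition relator_category :: "('a, 'a) small_category" where
  "relator_category = \<lparr>Obj = term_code ` relators,
     Arr = (\<lambda>i j. if below (term_decode i) (term_decode j) then {\<u>} else {}),
     Ide = (\<lambda>_. \<u>), Comp = (\<lambda>_ _ _ _ _. \<u>)\<rparr>"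

definition relator_object :: "'a \<Rightarrow> 'a ulgroup" where
  "relator_object i = presented (term_decode i)"

definition relator_arrow :: "'a \<Rightarrow> 'a \<Rightarrow> 'a \<Rightarrow> 'a \<Rightarrow> 'a" where
  "relator_arrow i j f = transition (term_decode i) (term_decode j)"

lemma relator_category_simps [simp]:
  "i \<in> Obj relator_category \<longleftrightarrow> (\<exists>t\<in>relators. i = term_code t)"
  "f \<in> Arr relator_category i j \<longleftrightarrow> below (term_decode i) (term_decode j) \<and> f = \<u>"
  "Arr relator_category i j = {} \<longleftrightarrow> \<not> below (term_decode i) (term_decode j)"
  "Ide relator_category i = \<u>" "Comp relator_category i j k g f = \<u>"
  by (auto simp: relator_category_def)

lemma filtered_relator_category: "filtered_category relator_category"
proof
  show "\<exists>k\<in>Obj relator_category. Arr relator_category i k \<noteq> {} \<and> Arr relator_category j k \<noteq> {}"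
    if ij: "i \<in> Obj relator_category" "j \<in> Obj relator_category" for i j
  proof -
    obtain t t' where t: "t \<in> relators" "i = term_code t" "t' \<in> relators" "j = term_code t'"
      using ij by auto
    show ?thesis
      by (rule bexI [of _ "term_code (join_relator t t')"]) (use t join_relator in auto)
  qed
  show "Obj relator_category \<noteq> {}"
    using var_relator(1) [OF unit_closed] by (auto simp: relator_category_def)
  show "\<exists>k\<in>Obj relator_category. \<exists>h\<in>Arr relator_category j k.
      Comp relator_category i j k h f = Comp relator_category i j k h g"
    if "j \<in> Obj relator_category" for i j f g
    by (rule bexI [of _ j]) (use that in \<open>auto intro: bexI [of _ \<u>]\<close>)
qed (auto intro: below_trans)

lemma relator_diagram: "ulg_diagram relator_category relator_object relator_arrow"
proof -
  interpret filtered_category relator_category by (rule filtered_relator_category)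
  show ?thesis
  proof (intro ulg_diagram.intro ulg_diagram_axioms.intro)
    show "small_category relator_category" by unfold_locales
    show "unital_lgroup (relator_object i)" if "i \<in> Obj relator_category" for i
      using that by (auto simp: relator_object_def unital_lgroup_presented)
    show "relator_arrow i j f \<in> ulg_hom (relator_object i) (relator_object j)"
      if "i \<in> Obj relator_category" "j \<in> Obj relator_category" "f \<in> Arr relator_category i j" for i j f
      using that by (auto simp: relator_object_def relator_arrow_def transition_hom)
    show "relator_arrow i i (Ide relator_category i) = restrict id (carrier (relator_object i))" for i
      unfolding relator_arrow_def relator_object_def
      by (rule presented_ext [of _ "term_decode i"])
        (simp_all add: transition_code code_in_presented, simp add: transition_def induced_def)
    show "relator_arrow i k (Comp relator_category i j k g f) =
        compose (carrier (relator_object i)) (relator_arrow j k g) (relator_arrow i j f)"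
      if "f \<in> Arr relator_category i j" "g \<in> Arr relator_category j k" for i j k f g
    proof -
      have *: "below (term_decode i) (term_decode j)" "below (term_decode j) (term_decode k)"
        using that by auto
      have sub: "support (term_decode i) \<subseteq> support (term_decode j)" using * by (simp add: below_def)
      show ?thesis
        unfolding relator_arrow_def relator_object_def
      proof (rule presented_ext)
        fix s assume s: "term_vars s \<subseteq> support (term_decode i)"
        show "transition (term_decode i) (term_decode k) (code (term_decode i) s) =
            compose (carrier (presented (term_decode i))) (transition (term_decode j) (term_decode k))
             (transition (term_decode i) (term_decode j)) (code (term_decode i) s)"
          using s * sub below_trans [OF *]
          by (simp add: compose_def code_in_presented transition_code subset_trans [OF s sub])
      qed (auto simp: transition_def induced_def compose_def)
    qed
  qed
qed

definition relator_cocone :: "'a \<Rightarrow> 'a \<Rightarrow> 'a" where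
  "relator_cocone i = canonical (term_decode i)"

text \<open>Translates commuting triangles into identities between values on terms; the cocone
  property and the universal property are checked in that form.\<close>

lemma compose_transition_eq_iff:
  assumes "below t t'" "h \<in> extensional (carrier (presented t))"
  shows "compose (carrier (presented t)) k (transition t t') = h \<longleftrightarrow>
    (\<forall>s. term_vars s \<subseteq> support t \<longrightarrow> k (code t' s) = h (code t s))"
proof
  assume "compose (carrier (presented t)) k (transition t t') = h"
  then show "\<forall>s. term_vars s \<subseteq> support t \<longrightarrow> k (code t' s) = h (code t s)"
    by (metis code_in_presented compose_eq transition_code [OF assms(1)])
next
  assume "\<forall>s. term_vars s \<subseteq> support t \<longrightarrow> k (code t' s) = h (code t s)"
  then show "compose (carrier (presented t)) k (transition t t') = h"
    by (intro presented_ext [OF _ assms(2)])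
      (auto simp: code_in_presented compose_eq transition_code [OF assms(1)])
qed

lemma relator_cocone: "ulg_cocone relator_category relator_object relator_arrow G relator_cocone"
  unfolding ulg_cocone_def
proof (intro conjI ballI)
  show "unital_lgroup G" by (rule unital_lgroup_axioms)
  show "relator_cocone i \<in> ulg_hom (relator_object i) G" if "i \<in> Obj relator_category" for i
    using that by (auto simp: relator_cocone_def relator_object_def canonical_hom)
  show "compose (carrier (relator_object i)) (relator_cocone j) (relator_arrow i j f) = relator_cocone i"
    if ij: "i \<in> Obj relator_category" "j \<in> Obj relator_category" "f \<in> Arr relator_category i j" for i j f
  proof -
    obtain t t' where t: "t \<in> relators" "i = term_code t" "t' \<in> relators" "j = term_code t'" "below t t'"
      using ij by auto
    have "support t \<subseteq> support t'" using t(5) by (simp add: below_def)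
    then show ?thesis
      using t ulg_homD(1) [OF canonical_hom [OF t(1)]]
      by (simp add: relator_cocone_def relator_object_def relator_arrow_def compose_transition_eq_iff
          canonical_code subset_trans)
  qed
qed

text \<open>Every element of G appears as a variable at some index, and every equation between terms
  that holds in G is itself a relator, hence holds from some index on. The mediating map is
  therefore forced, and it may be computed at any index.\<close>

lemma relator_colimit: "ulg_colimit relator_category relator_object relator_arrow G relator_cocone"
  unfolding ulg_colimit_def
proof (intro conjI allI impI)
  show "ulg_cocone relator_category relator_object relator_arrow G relator_cocone"
    by (rule relator_cocone)
  fix M d assume cocone: "ulg_cocone relator_category relator_object relator_arrow M d"
  define e where "e t = d (term_code t)" for t
  have e_hom: "e t \<in> ulg_hom (presented t) M" if "t \<in> relators" for t
  proof -
    have "term_code t \<in> Obj relator_category" using that by auto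
    then have "d (term_code t) \<in> ulg_hom (relator_object (term_code t)) M"
      using cocone unfolding ulg_cocone_def by blast
    then show ?thesis by (simp add: relator_object_def e_def)
  qed
  have e_below: "e t' (code t' s) = e t (code t s)"
    if "t \<in> relators" "t' \<in> relators" "below t t'" "term_vars s \<subseteq> support t" for t t' s
  proof -
    have "term_code t \<in> Obj relator_category" "term_code t' \<in> Obj relator_category"
      "\<u> \<in> Arr relator_category (term_code t) (term_code t')" using that by auto
    then have "compose (carrier (relator_object (term_code t))) (d (term_code t'))
        (relator_arrow (term_code t) (term_code t') \<u>) = d (term_code t)"
      using cocone unfolding ulg_cocone_def by blast
    then have "compose (carrier (presented t)) (e t') (transition t t') = e t"
      by (simp add: relator_object_def relator_arrow_def e_def)
    then show ?thesis
      using that compose_transition_eq_iff [OF that(3) ulg_homD(1) [OF e_hom [OF that(1)]]] by simp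
  qed
  \<comment> \<open>The vacuous relator of \<open>x\<close> is a uniform choice of an index at which
    \<open>x\<close> is available; \<open>h_eval\<close> shows independence of this choice.\<close>
  define h where "h = (\<lambda>x\<in>carrier G. e (var_relator x) (code (var_relator x) (Var x)))"
  have h_eval: "h (eval s) = e t (code t s)" if t: "t \<in> relators" "term_vars s \<subseteq> support t" for t s
  proof -
    have x: "eval s \<in> carrier G" using t by (rule eval_in_carrier)
    define v where "v = var_relator (eval s)"
    have v: "v \<in> relators" "eval s \<in> support v" using x by (auto simp: v_def var_relator)
    \<comment> \<open>The equation of \<open>s\<close> with the variable named by its value holds in
      G, so it is a relator. At the index \<open>w\<close> beyond it the two terms have the same
      code.\<close>
    define r where "r = Add s (Neg (Var (eval s)))"
    have r: "r \<in> relators"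
      using x t support_closed [OF t(1)] by (auto simp: r_def relators_def)
    define w where "w = join_relator r (join_relator t v)"
    note tv = join_relator [OF t(1) v(1)]
    have w: "w \<in> relators" "below r w" "below t w" "below v w"
      using join_relator [OF r tv(1)] tv below_trans by (auto simp: w_def)
    have "int_eval q r = 0" if "q \<in> points w" for q
      using w(2) that by (auto simp: below_def points_def int_points_def)
    then have "code w s = code w (Var (eval s))"
      using w(3,4) t v(2) by (auto simp: code_eq_iff below_def r_def)
    then show ?thesis
      using e_below [OF t(1) w(1) w(3) t(2)] e_below [OF v(1) w(1) w(4), of "Var (eval s)"] v(2) x
      by (simp add: h_def v_def)
  qed
  have rep: "\<exists>t\<in>relators. x \<in> support t \<and> y \<in> support t" if "x \<in> carrier G" "y \<in> carrier G" for x y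
    using relator_with_support [of "{x, y}"] that by auto
  have h_hom: "h \<in> ulg_hom G M"
  proof (rule ulg_homI [OF unital_lgroup_axioms])
    show "unital_lgroup M" using cocone by (simp add: ulg_cocone_def)
    show "h \<in> extensional (carrier G)" by (simp add: h_def)
    show "h \<u> = ulg_unit M"
    proof -
      obtain t where t: "t \<in> relators" using rep unit_closed by blast
      then show ?thesis
        using h_eval [OF t, of "Var \<u>"] ulg_homD(5) [OF e_hom [OF t]] presented_ops(3) [OF t, of "Var \<u>" "Var \<u>"]
        by simp
    qed
    fix x y assume xy: "x \<in> carrier G" "y \<in> carrier G"
    obtain t where t: "t \<in> relators" "x \<in> support t" "y \<in> support t" using rep [OF xy] by auto
    note ev = h_eval [OF t(1)]
    have in_t: "code t (Var x) \<in> carrier (presented t)" "code t (Var y) \<in> carrier (presented t)"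
      using t by (auto intro: code_in_presented)
    show "h x \<in> carrier M"
      using ev [of "Var x"] t ulg_homD(2) [OF e_hom [OF t(1)] in_t(1)] by simp
    show "h (x \<otimes> y) = h x \<otimes>\<^bsub>M\<^esub> h y"
      using ev [of "Var x"] ev [of "Var y"] ev [of "Add (Var x) (Var y)"] t
        ulg_homD(3) [OF e_hom [OF t(1)] in_t] presented_ops(1) [OF t(1), of "Var x" "Var y"] by simp
    show "h (x \<curlyvee> y) = h x \<squnion>\<^bsub>ulg_order M\<^esub> h y"
      using ev [of "Var x"] ev [of "Var y"] ev [of "Max (Var x) (Var y)"] t
        ulg_homD(4) [OF e_hom [OF t(1)] in_t] presented_ops(2) [OF t(1), of "Var x" "Var y"] by simp
  qed
  have factor_iff: "compose (carrier (relator_object i)) k (relator_cocone i) = d i \<longleftrightarrow>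
      (\<forall>s. term_vars s \<subseteq> support t \<longrightarrow> k (eval s) = e t (code t s))"
    if "t \<in> relators" "i = term_code t" for i t k
  proof -
    have "compose (carrier (presented t)) k (canonical t) = e t \<longleftrightarrow>
      (\<forall>s. term_vars s \<subseteq> support t \<longrightarrow> k (eval s) = e t (code t s))"
    proof
      assume "compose (carrier (presented t)) k (canonical t) = e t"
      then show "\<forall>s. term_vars s \<subseteq> support t \<longrightarrow> k (eval s) = e t (code t s)"
        by (metis code_in_presented compose_eq canonical_code [OF that(1)])
    next
      assume "\<forall>s. term_vars s \<subseteq> support t \<longrightarrow> k (eval s) = e t (code t s)"
      then show "compose (carrier (presented t)) k (canonical t) = e t"
        by (intro presented_ext [OF _ ulg_homD(1) [OF e_hom [OF that(1)]]])
          (auto simp: code_in_presented compose_eq canonical_code [OF that(1)])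
    qed
    then show ?thesis by (simp add: that relator_object_def relator_cocone_def e_def)
  qed
  show "\<exists>!h. h \<in> ulg_hom G M \<and>
      (\<forall>i\<in>Obj relator_category. compose (carrier (relator_object i)) h (relator_cocone i) = d i)"
  proof (rule ex1I [of _ h])
    show "h \<in> ulg_hom G M \<and>
      (\<forall>i\<in>Obj relator_category. compose (carrier (relator_object i)) h (relator_cocone i) = d i)"
      using h_hom h_eval by (auto simp: factor_iff)
    fix k assume k: "k \<in> ulg_hom G M \<and>
      (\<forall>i\<in>Obj relator_category. compose (carrier (relator_object i)) k (relator_cocone i) = d i)"
    show "k = h"
    proof (rule extensionalityI [of _ "carrier G"])
      fix x assume "x \<in> carrier G"
      then have v: "var_relator x \<in> relators" "x \<in> support (var_relator x)" by (auto simp: var_relator)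
      then have "term_code (var_relator x) \<in> Obj relator_category" by auto
      then have "compose (carrier (relator_object (term_code (var_relator x)))) k
          (relator_cocone (term_code (var_relator x))) = d (term_code (var_relator x))"
        using k by blast
      then have "\<forall>s. term_vars s \<subseteq> support (var_relator x) \<longrightarrow> k (eval s) = e (var_relator x) (code (var_relator x) s)"
        by (simp only: factor_iff [OF v(1) refl])
      from spec [OF this, of "Var x"] have "k x = e (var_relator x) (code (var_relator x) (Var x))"
        using v(2) by simp
      then show "k x = h x" using \<open>x \<in> carrier G\<close> by (simp add: h_def)
    qed (use k h_hom ulg_homD(1) in auto)
  qed
qed

end

text \<open>The cocone identities make the composite invariant under each generating step, hence
  constant on the class. The image in \<open>hom_colimit_map\<close> is thus a singleton, and
  \<open>the_elem\<close> returns its element.\<close>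

lemma hom_colimit_map_class:
  assumes "ulg_cocone J D T L c" "(i, g) \<in> X" "X \<in> hom_colimit G J D T"
  shows "(i, g) \<in> hom_sum G J D" "hom_colimit_map G c X = compose (carrier G) (c i) g"
proof -
  let ?R = "{(p, q) \<in> hom_sum G J D \<times> hom_sum G J D. equivclp (hom_step G J D T) p q}"
  let ?f = "\<lambda>(i, g). compose (carrier G) (c i) g"
  have step: "?f p = ?f q" if pq: "hom_step G J D T p q" for p q
  proof -
    obtain i g where p: "p = (i, g)" by (cases p)
    obtain j g' where q: "q = (j, g')" by (cases q)
    obtain f where f: "f \<in> Arr J i j" "g' = compose (carrier G) (T i j f) g"
      and ij: "i \<in> Obj J" "j \<in> Obj J" "g \<in> ulg_hom G (D i)"
      using pq by (auto simp: p q hom_step_def hom_sum_def)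
    have "compose (carrier (D i)) (c j) (T i j f) = c i"
      using assms(1) ij f by (simp add: ulg_cocone_def)
    then have "c i (g x) = c j (T i j f (g x))" if "x \<in> carrier G" for x
      using ulg_homD(2) [OF ij(3) that] by (metis compose_eq)
    then show ?thesis by (auto simp: p q f compose_def fun_eq_iff)
  qed
  have equiv: "?f p = ?f q" if "equivclp (hom_step G J D T) p q" for p q
    using that by (induction rule: equivclp_induct) (use step in auto)
  obtain p where p: "X = ?R `` {p}" using assms(3) by (auto simp: hom_colimit_def quotient_def)
  then show "(i, g) \<in> hom_sum G J D" using assms(2) by auto
  have "?f q = ?f (i, g)" if "q \<in> X" for q
    using that assms(2) equiv [of p q] equiv [of p "(i, g)"] by (auto simp: p)
  then have "?f ` X = {?f (i, g)}" using assms(2) by blast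
  then show "hom_colimit_map G c X = compose (carrier G) (c i) g"
    by (simp add: hom_colimit_map_def)
qed

section \<open>Factoring the identity of G through a group of functions\<close>

context plain_unital_lgroup
begin

lemma id_hom: "restrict id (carrier G) \<in> ulg_hom G G"
  by (rule ulg_homI) (auto simp: unital_lgroup_axioms unit_closed)

text \<open>The identity of G has a preimage in the colimit of the hom-sets, and every
  representative of that class is a section.\<close>

lemma finitely_presented_section:
  assumes "finitely_presented G"
  shows "\<exists>t\<in>relators. \<exists>\<theta>\<in>ulg_hom G (presented t). \<forall>x\<in>carrier G. canonical t (\<theta> x) = x"
proof -
  let ?C = "hom_colimit G relator_category relator_object relator_arrow"
  have "bij_betw (hom_colimit_map G relator_cocone) ?C (ulg_hom G G)"
    using assms filtered_relator_category relator_diagram relator_colimit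
    unfolding finitely_presented_def by blast
  then obtain X where X: "X \<in> ?C" "hom_colimit_map G relator_cocone X = restrict id (carrier G)"
    using id_hom unfolding bij_betw_def by (metis imageE)
  have "X \<noteq> {}" using X(1) by (auto simp: hom_colimit_def quotient_def)
  then obtain i g where "(i, g) \<in> X" by (metis ex_in_conv surj_pair)
  from hom_colimit_map_class [OF relator_cocone this X(1)] X(2)
  have "i \<in> Obj relator_category" and g: "g \<in> ulg_hom G (relator_object i)"
    and eq: "compose (carrier G) (relator_cocone i) g = restrict id (carrier G)"
    by (auto simp: hom_sum_def)
  then obtain t where t: "t \<in> relators" "i = term_code t" by auto
  have "canonical t (g x) = x" if "x \<in> carrier G" for x
    using fun_cong [OF eq, of x] that by (simp add: t relator_cocone_def compose_eq)
  then show ?thesis using t g by (auto simp: relator_object_def)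
qed

text \<open>Once one support contains all generators, the canonical map is onto, and projectivity
  lifts the identity along it.\<close>

lemma projective_section:
  assumes "finitely_generated G" "projective G"
  shows "\<exists>t\<in>relators. \<exists>\<theta>\<in>ulg_hom G (presented t). \<forall>x\<in>carrier G. canonical t (\<theta> x) = x"
proof -
  obtain X where X: "finite X" "X \<subseteq> carrier G" "\<And>S. unital_lsubgroup S G \<Longrightarrow> X \<subseteq> S \<Longrightarrow> S = carrier G"
    using assms(1) by (auto simp: finitely_generated_def)
  obtain t where t: "t \<in> relators" "X \<subseteq> support t" using relator_with_support [OF X(1,2)] by blast
  let ?T = "eval ` {s. term_vars s \<subseteq> support t}"
  have "X \<subseteq> ?T"
  proof
    fix x assume "x \<in> X"
    then have "Var x \<in> {s. term_vars s \<subseteq> support t}" using t by auto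
    then show "x \<in> ?T" by (rule rev_image_eqI) simp
  qed
  then have "?T = carrier G"
    using generated_by_terms [OF support_closed [OF t(1)]] X(3) by simp
  moreover have "canonical t ` carrier (presented t) = ?T"
    by (auto simp: presented_def image_image canonical_code [OF t(1)])
  ultimately have "canonical t \<in> ulg_epi (presented t) G"
    using canonical_hom [OF t(1)] by (simp add: ulg_epi_def)
  then obtain \<theta> where \<theta>: "\<theta> \<in> ulg_hom G (presented t)"
    "restrict id (carrier G) = compose (carrier G) (canonical t) \<theta>"
    using assms(2) unital_lgroup_presented [OF t(1)] unital_lgroup_axioms id_hom
    unfolding projective_def by blast
  have "canonical t (\<theta> x) = x" if "x \<in> carrier G" for x
    using fun_cong [OF \<theta>(2), of x] that by (simp add: compose_eq)
  then show ?thesis using t \<theta> by blast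
qed

end

theorem corollary3p3:
  fixes G :: "'a ulgroup"
  assumes "unital_lgroup G"
  shows "(finitely_presented G \<longrightarrow> hopfian G) \<and>
         (finitely_generated G \<and> projective G \<longrightarrow> hopfian G)"
proof -
  interpret unital_lgroup G by fact
  interpret plain_unital_lgroup G by unfold_locales
  show ?thesis
    using finitely_presented_section projective_section hopfian_if_section by blast
qed

end
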